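(* Consider the edge-reinforced random walk on $\mathbb{Z}$ with $k\ge 1$ walkers $X^{(1)},\dots,X^{(k)}$ (as defined in the context), started with an initial configuration of weights $w(0,j)$, $j\in\mathbb{Z}$, such that all but finitely many of them are equal to $1$. Then $$\mathbb{P}\left[\forall m\in\{1,\dots,k\}:\ X^{(m)}\text{ is recurrent}\right]+\mathbb{P}\left[\forall m\in\{1,\dots,k\}:\ X^{(m)}\text{ has finite range}\right]=1 .$$
   Context: Edge-reinforced random walk on $\mathbb{Z}$ with $k$ walkers: the edge $\{j,j+1\}$ is denoted by $j\in\mathbb{Z}$ and has weight $w(n,j)>0$ at time $n\ge 0$. The initial weights $w(0,j)>0$ and the initial positions $X^{(m)}_0\in\mathbb{Z}$, $1\le m\le k$, are arbitrary (deterministic). Let $\mathcal{G}_n$ be the $\sigma$-algebra generated by all walker positions and edge weights up to and including time $n$. Conditionally on $\mathcal{G}_n$, the step from time $n$ to $n+1$ is: a walker $m$ is chosen uniformly at random among the $k$ walkers, independently of $\mathcal{G}_n$. If $X^{(m)}_n=j$, then $X^{(m)}_{n+1}=j+1$ with probability $\frac{w(n,j)}{w(n,j-1)+w(n,j)}$ and $X^{(m)}_{n+1}=j-1$ with probability $\frac{w(n,j-1)}{w(n,j-1)+w(n,j)}$; all other walkers stay where they are. If $j^\ast$ is the traversed edge, then $w(n+1,i)=w(n,i)$ for $i\ne j^\ast$ and $w(n+1,j^\ast)\ge w(n,j^\ast)$, where the increment depends only on $j^\ast$ and the number of times the edge $j^\ast$ has been crossed (by any walker) up to that time; i.e. $w(n,j)=W_j(z(n,j))$,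 where $z(n,j)$ is the number of crossings of edge $j$ (by any walker, in any direction) up to time $n$ and $W_j:\mathbb{N}_{\ge 0}\to(0,\infty)$ is a fixed nondecreasing function for each $j$. A walker $m$ is recurrent if every integer appears infinitely often in the sequence $(X^{(m)}_n)_n$; it has finite range if only finitely many distinct integers appear in this sequence. *)

theory Defs
  imports "HOL-Probability.Probability"
begin

text \<open>
  The edge between \<open>j\<close> and \<open>j + 1\<close> is denoted by the integer \<open>j\<close>. The walkers are numbered
  \<open>1, \<dots>, k\<close>, and \<open>X m n \<omega>\<close> is the position of walker \<open>m\<close> at time \<open>n\<close>; values of \<open>X\<close> at other
  indices \<open>m\<close> are irrelevant.
\<close>

definition crossings ::
  "nat \<Rightarrow> (nat \<Rightarrow> nat \<Rightarrow> 'a \<Rightarrow> int) \<Rightarrow> nat \<Rightarrow> int \<Rightarrow> 'a \<Rightarrow> nat" where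
  "crossings k X n j \<omega> =
     card {(m, i). m \<in> {1..k} \<and> i < n \<and> {X m i \<omega>, X m (Suc i) \<omega>} = {j, j + 1}}"

definition weight ::
  "nat \<Rightarrow> (int \<Rightarrow> nat \<Rightarrow> real) \<Rightarrow> (nat \<Rightarrow> nat \<Rightarrow> 'a \<Rightarrow> int) \<Rightarrow> nat \<Rightarrow> int \<Rightarrow> 'a \<Rightarrow> real" where
  "weight k W X n j \<omega> = W j (crossings k X n j \<omega>)"

definition history ::
  "'a measure \<Rightarrow> nat \<Rightarrow> (int \<Rightarrow> nat \<Rightarrow> real) \<Rightarrow> (nat \<Rightarrow> nat \<Rightarrow> 'a \<Rightarrow> int) \<Rightarrow> nat \<Rightarrow> 'a measure" where
  "history M k W X n = sigma (space M)
     ({X m i -` A \<inter> space M | m i A. m \<in> {1..k} \<and> i \<le> n} \<union>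
      {weight k W X i j -` B \<inter> space M | i j B. i \<le> n \<and> B \<in> sets borel})"

text \<open>
  The law of the next configuration when the current configuration is \<open>x\<close> and the current
  weight of edge \<open>j\<close> is \<open>v j\<close>.
\<close>

definition step_law :: "nat \<Rightarrow> (int \<Rightarrow> real) \<Rightarrow> (nat \<Rightarrow> int) \<Rightarrow> (nat \<Rightarrow> int) pmf" where
  "step_law k v x =
     bind_pmf (pmf_of_set {1..k}) (\<lambda>m.
       map_pmf (\<lambda>right. x(m := if right then x m + 1 else x m - 1))
         (bernoulli_pmf (v (x m) / (v (x m - 1) + v (x m)))))"

text \<open>
  In the last assumption, \<open>y\<close> ranges over the possible next configurations. Since the set of
  configurations of \<open>k\<close> walkers is countable, the assumption determines the conditional
  distribution of the configuration at time \<open>n + 1\<close> given the history up to time \<open>n\<close>.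
\<close>

locale edge_reinforced_walkers = prob_space M
  for M :: "'a measure" +
  fixes k :: nat
    and W :: "int \<Rightarrow> nat \<Rightarrow> real"
    and x0 :: "nat \<Rightarrow> int"
    and X :: "nat \<Rightarrow> nat \<Rightarrow> 'a \<Rightarrow> int"
  assumes at_least_one_walker: "k \<ge> 1"
    and weight_function_pos: "\<And>j i. W j i > 0"
    and weight_function_mono: "\<And>j. mono (W j)"
    and walker_measurable: "\<And>m n. m \<in> {1..k} \<Longrightarrow> X m n \<in> measurable M (count_space UNIV)"
    and initial_position: "\<And>m. m \<in> {1..k} \<Longrightarrow> AE \<omega> in M. X m 0 \<omega> = x0 m"
    and transition: "\<And>n y. AE \<omega> in M.
      real_cond_exp M (history M k W X n)
        (indicator {\<omega>' \<in> space M. \<forall>m\<in>{1..k}. X m (Suc n) \<omega>' = y m}) \<omega> =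
      measure_pmf.prob (step_law k (\<lambda>j. weight k W X n j \<omega>) (\<lambda>m. X m n \<omega>))
        {x. \<forall>m\<in>{1..k}. x m = y m}"

definition recurrent_path :: "(nat \<Rightarrow> int) \<Rightarrow> bool" where
  "recurrent_path p \<longleftrightarrow> (\<forall>x. infinite {n. p n = x})"

definition finite_range_path :: "(nat \<Rightarrow> int) \<Rightarrow> bool" where
  "finite_range_path p \<longleftrightarrow> finite (range p)"

end

theory Submission
  imports Defs "HOL-Combinatorics.Transposition"
begin

text \<open>
  For a walker that eventually stays on one side of a vertex, the resistance between that vertex and
  the walker is a nonnegative supermartingale, because reinforcement only lowers resistances. Its
  martingale part therefore has square-summable increments, and since a fresh edge has weight \<open>1\<close>
  (up to finitely many exceptions), the walker is almost surely the first to cross only finitely many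
  edges. If no walker is recurrent, each of them is eventually one-sided, so finitely many edges are
  ever crossed. If some walker is recurrent, infinitely many edges to the right are discovered,
  hence infinitely many by a single walker \<open>i\<close>, which must itself be recurrent. A walker that
  eventually stays to the right of some vertex would then meet \<open>i\<close> infinitely often. But two walkers
  that meet infinitely often are interchangeable after each meeting, so almost surely both are
  recurrent or neither is. The left side is symmetric.
\<close>

section \<open>Paths of the walkers\<close>

text \<open>One-sidedness holds only from a path-dependent time on and with a path-dependent
  barrier, so it cannot be imposed on the martingale in advance. The only trace of it that is used
  is a lower bound \<open>-K\<close> on the signed sum of increments. For fixed \<open>K\<close> and
  \<open>L\<close> this sum is frozen on leaving \<open>[-K, L]\<close>: it then exceeds
  \<open>L\<close> with probability at most \<open>(K + C) / L\<close>, where \<open>C\<close>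
  bounds one increment, and its expected sum of squares is bounded. Letting \<open>L\<close> grow,
  for every natural \<open>K\<close>, covers all one-sided paths. Walkers are interchangeable
  although their positions alone are not Markov: the weights depend on the past through crossing
  numbers, which count all walkers alike, so a swap of two labels at a meeting leaves them
  unchanged. As the meeting may be taken later than any given time, the swap also does the work of a
  zero-one law. Up to a fixed time the path has finitely many possible values, so the martingale
  identities are finite sums.\<close>

lemma finite_crossings:
  "finite {(m, i). m \<in> {1..k::nat} \<and> i < (n::nat) \<and> P m i}"
  by (rule finite_subset[of _ "{1..k} \<times> {..<n}"]) auto

lemma crossings_0 [simp]: "crossings k X 0 j \<omega> = 0"
  by (simp add: crossings_def)

lemma crossings_Suc:
  "crossings k X (Suc n) j \<omega> =
     crossings k X n j \<omega> + card {m \<in> {1..k}. {X m n \<omega>, X m (Suc n) \<omega>} = {j, j + 1}}"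
proof -
  let ?P = "\<lambda>m i. {X m i \<omega>, X m (Suc i) \<omega>} = {j, j + 1}"
  let ?A = "{(m, i). m \<in> {1..k} \<and> i < n \<and> ?P m i}"
  let ?B = "{m \<in> {1..k}. ?P m n}"
  have "{(m, i). m \<in> {1..k} \<and> i < Suc n \<and> ?P m i} = ?A \<union> (\<lambda>m. (m, n)) ` ?B"
    by (auto simp: less_Suc_eq)
  moreover have "card (?A \<union> (\<lambda>m. (m, n)) ` ?B) = card ?A + card ((\<lambda>m. (m, n)) ` ?B)"
    by (intro card_Un_disjoint finite_crossings) auto
  moreover have "card ((\<lambda>m. (m, n)) ` ?B) = card ?B"
    by (intro card_image) (auto simp: inj_on_def)
  ultimately show ?thesis
    by (simp add: crossings_def)
qed

lemma crossings_mono: "n \<le> n' \<Longrightarrow> crossings k X n j \<omega> \<le> crossings k X n' j \<omega>"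
  by (induction rule: dec_induct) (auto simp: crossings_Suc)

lemma crossings_cong:
  assumes "\<And>m i. m \<in> {1..k} \<Longrightarrow> i \<le> n \<Longrightarrow> X m i \<omega> = Y m i \<eta>"
  shows "crossings k X n j \<omega> = crossings k Y n j \<eta>"
  using assms
proof (induction n)
  case (Suc n)
  have "{m \<in> {1..k}. {X m n \<omega>, X m (Suc n) \<omega>} = {j, j + 1}} =
        {m \<in> {1..k}. {Y m n \<eta>, Y m (Suc n) \<eta>} = {j, j + 1}}"
    using Suc.prems by (intro Collect_cong) auto
  with Suc show ?case
    by (simp add: crossings_Suc)
qed simp

text \<open>
  A path is a function \<open>c\<close> such that \<open>c n m\<close> is the position of walker \<open>m\<close> at time \<open>n\<close>: time comes
  first, so that \<open>c n\<close> is a configuration.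
\<close>

abbreviation path_crossings :: "nat \<Rightarrow> (nat \<Rightarrow> nat \<Rightarrow> int) \<Rightarrow> nat \<Rightarrow> int \<Rightarrow> nat" where
  "path_crossings k c n j \<equiv> crossings k (\<lambda>m i c. c i m) n j c"

definition legal_step :: "nat \<Rightarrow> (nat \<Rightarrow> int) \<Rightarrow> (nat \<Rightarrow> int) \<Rightarrow> bool" where
  "legal_step k x y \<longleftrightarrow> (\<exists>m\<in>{1..k}. \<exists>s\<in>{1, -1}. y = x(m := x m + s))"

text \<open>Times rather than edges are collected because martingale increments are indexed by time;
  at these times the crossed edge still has its initial weight.\<close>

definition fresh_right :: "nat \<Rightarrow> (nat \<Rightarrow> nat \<Rightarrow> int) \<Rightarrow> nat \<Rightarrow> nat set" where
  "fresh_right k c m = {i. c (Suc i) m = c i m + 1 \<and> path_crossings k c i (c i m) = 0}"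

definition fresh_left :: "nat \<Rightarrow> (nat \<Rightarrow> nat \<Rightarrow> int) \<Rightarrow> nat \<Rightarrow> nat set" where
  "fresh_left k c m = {i. c (Suc i) m = c i m - 1 \<and> path_crossings k c i (c i m - 1) = 0}"

text \<open>Negation maps \<open>j\<close>, \<open>j + 1\<close> to \<open>-j\<close>,
  \<open>-j - 1\<close>, the ends of edge \<open>-1 - j\<close>.\<close>

lemma path_crossings_reflect:
  "path_crossings k (\<lambda>n m. - c n m) n j = path_crossings k c n (- 1 - j)"
proof (induction n)
  case (Suc n)
  have "{m \<in> {1..k}. {- c n m, - c (Suc n) m} = {j, j + 1}} =
        {m \<in> {1..k}. {c n m, c (Suc n) m} = {- 1 - j, - 1 - j + 1}}"
    by (intro Collect_cong conj_cong refl) (auto simp: doubleton_eq_iff)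
  with Suc show ?case
    by (simp add: crossings_Suc)
qed simp

lemma fresh_right_reflect: "fresh_right k (\<lambda>n m. - c n m) m = fresh_left k c m"
  by (auto simp: fresh_right_def fresh_left_def path_crossings_reflect algebra_simps)

lemma recurrent_path_iff: "recurrent_path p \<longleftrightarrow> (\<forall>x. \<exists>\<^sub>F n in sequentially. p n = x)"
  by (simp add: recurrent_path_def frequently_cofinite[symmetric] cofinite_eq_sequentially)

lemma recurrent_path_cong:
  assumes "\<And>n. n \<ge> N \<Longrightarrow> p n = q n"
  shows "recurrent_path p = recurrent_path q"
proof -
  have *: "\<forall>\<^sub>F n in sequentially. p n = q n"
    using assms unfolding eventually_sequentially by blast
  show ?thesis
    unfolding recurrent_path_iff
    by (intro all_cong1 frequently_cong[OF *]) simp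
qed

lemma recurrent_path_reflect: "recurrent_path (\<lambda>n. - p n) \<longleftrightarrow> recurrent_path p"
proof -
  have "{n. - p n = x} = {n. p n = - x}" for x by auto
  moreover have "(\<forall>x. infinite {n. p n = - x}) \<longleftrightarrow> (\<forall>x. infinite {n. p n = x})"
    by (metis (mono_tags) minus_minus)
  ultimately show ?thesis
    by (simp add: recurrent_path_def)
qed

text \<open>Steps of size at most 1 cannot jump over \<open>a\<close>. Besides positions, this is
  applied to the difference of two walkers.\<close>

lemma int_path_one_sided:
  fixes p :: "nat \<Rightarrow> int"
  assumes step: "\<And>n. \<bar>p (Suc n) - p n\<bar> \<le> 1" and avoid: "\<And>n. n \<ge> N \<Longrightarrow> p n \<noteq> a"
  shows "(\<forall>n\<ge>N. p n > a) \<or> (\<forall>n\<ge>N. p n < a)"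
proof -
  have "(p n > a) = (p N > a)" if "n \<ge> N" for n
    using that
  proof (induction rule: dec_induct)
    case (step n)
    have "p n \<noteq> a" "p (Suc n) \<noteq> a"
      using step avoid[of n] avoid[of "Suc n"] by auto
    with step.IH \<open>\<bar>p (Suc n) - p n\<bar> \<le> 1\<close> show ?case by linarith
  qed simp
  with avoid show ?thesis
    by (metis linorder_neqE)
qed

section \<open>Deterministic dichotomy along a single path\<close>

locale legal_path =
  fixes k :: nat and c :: "nat \<Rightarrow> nat \<Rightarrow> int"
  assumes legal: "\<And>n. legal_step k (c n) (c (Suc n))"
begin

lemma legal_path_reflect: "legal_path k (\<lambda>n m. - c n m)"
proof
  fix n
  obtain m s where ms: "m \<in> {1..k}" "s \<in> {1, -1}" "c (Suc n) = (c n)(m := c n m + s)"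
    using legal[of n] unfolding legal_step_def by blast
  show "legal_step k (\<lambda>m. - c n m) (\<lambda>m. - c (Suc n) m)"
    unfolding legal_step_def
    by (rule bexI[OF _ ms(1)], rule bexI[of _ "- s"]) (use ms in auto)
qed

lemma abs_step: "\<bar>c (Suc n) m - c n m\<bar> \<le> 1"
  using legal[of n] by (auto simp: legal_step_def)

text \<open>Only one walker moves at a time, so two walkers cannot change order without meeting;
  simultaneous moves could let them swap sides unmet.\<close>

lemma abs_step_diff: "\<bar>(c (Suc n) m - c (Suc n) m') - (c n m - c n m')\<bar> \<le> 1"
  using legal[of n] by (auto simp: legal_step_def)

lemma side_of_uncrossed_edge:
  assumes "m \<in> {1..k}" "path_crossings k c n j = 0"
  shows "c n m \<le> j \<longleftrightarrow> c 0 m \<le> j"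
  using assms(2)
proof (induction n)
  case (Suc n)
  then have 0: "path_crossings k c n j = 0"
    and "{m \<in> {1..k}. {c n m, c (Suc n) m} = {j, j + 1}} = {}"
    by (auto simp: crossings_Suc)
  with assms(1) have "{c n m, c (Suc n) m} \<noteq> {j, j + 1}" by blast
  then have "\<not> (c n m = j \<and> c (Suc n) m = j + 1)" "\<not> (c n m = j + 1 \<and> c (Suc n) m = j)"
    by auto
  with Suc.IH[OF 0] abs_step[of n m] show ?case by linarith
qed simp

text \<open>Whoever makes the first crossing of edge \<open>j\<close> finds it uncrossed; the
  induction on \<open>n\<close> locates that time.\<close>

lemma crossed_edge_fresh:
  assumes "path_crossings k c n j \<noteq> 0"
  shows "\<exists>m\<in>{1..k}. j \<in> (\<lambda>i. c i m) ` fresh_right k c m \<union> (\<lambda>i. c i m - 1) ` fresh_left k c m"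
  using assms
proof (induction n)
  case (Suc n)
  show ?case
  proof (cases "path_crossings k c n j = 0")
    case True
    with Suc.prems have "card {m \<in> {1..k}. {c n m, c (Suc n) m} = {j, j + 1}} \<noteq> 0"
      by (simp add: crossings_Suc)
    then have "{m \<in> {1..k}. {c n m, c (Suc n) m} = {j, j + 1}} \<noteq> {}"
      by (metis card.empty)
    then obtain m where m: "m \<in> {1..k}" "{c n m, c (Suc n) m} = {j, j + 1}"
      by auto
    from m(2) consider "c n m = j" "c (Suc n) m = j + 1" | "c n m = j + 1" "c (Suc n) m = j"
      by (auto simp: doubleton_eq_iff)
    then have "j \<in> (\<lambda>i. c i m) ` fresh_right k c m \<union> (\<lambda>i. c i m - 1) ` fresh_left k c m"
    proof cases
      case 1
      then show ?thesis
        using True by (intro UnI1 image_eqI[of _ _ n]) (auto simp: fresh_right_def)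
    next
      case 2
      then show ?thesis
        using True by (intro UnI2 image_eqI[of _ _ n]) (auto simp: fresh_left_def)
    qed
    with m(1) show ?thesis by blast
  qed (use Suc.IH in blast)
qed simp

text \<open>Nobody has passed a fresh edge yet, so a walker taking it rightwards leads all those
  that started to its left. This gives the times at which the recurrent explorer is not behind a
  walker supposed to stay on the right.\<close>

lemma fresh_right_start_le:
  assumes "m \<in> {1..k}" "i \<in> fresh_right k c m" "m' \<in> {1..k}" "c 0 m' \<le> c i m"
  shows "c i m' \<le> c i m"
  using assms side_of_uncrossed_edge[of m' i "c i m"] by (auto simp: fresh_right_def)

lemma fresh_right_ge_start:
  assumes "m \<in> {1..k}" "i \<in> fresh_right k c m"
  shows "c 0 m \<le> c i m"
  using assms side_of_uncrossed_edge[of m i "c i m"] by (auto simp: fresh_right_def)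

lemma fresh_left_less_start:
  assumes "m \<in> {1..k}" "i \<in> fresh_left k c m"
  shows "c i m - 1 < c 0 m"
  using assms side_of_uncrossed_edge[of m i "c i m - 1"] by (auto simp: fresh_left_def)

text \<open>Such edges are not to the left of the walker's start. From time \<open>N\<close> on they
  are at most \<open>a\<close>, and earlier times contribute finitely many.\<close>

lemma finite_fresh_right_edges:
  assumes "m \<in> {1..k}" "\<And>n. n \<ge> N \<Longrightarrow> c n m \<le> a"
  shows "finite ((\<lambda>i. c i m) ` fresh_right k c m)"
proof (rule finite_subset)
  show "(\<lambda>i. c i m) ` fresh_right k c m \<subseteq> (\<lambda>i. c i m) ` {..<N} \<union> {c 0 m..a}"
  proof
    fix j assume "j \<in> (\<lambda>i. c i m) ` fresh_right k c m"
    then obtain i where i: "i \<in> fresh_right k c m" "j = c i m" by auto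
    show "j \<in> (\<lambda>i. c i m) ` {..<N} \<union> {c 0 m..a}"
      using fresh_right_ge_start[OF assms(1) i(1)] assms(2)[of i] i(2)
      by (cases "i < N") auto
  qed
qed auto

lemma one_sided_if_not_recurrent:
  assumes "\<not> recurrent_path (\<lambda>n. c n m)"
  obtains N a where "\<forall>n\<ge>N. c n m > a" | N a where "\<forall>n\<ge>N. c n m < a"
proof -
  from assms obtain a where "\<not> (\<exists>\<^sub>F n in sequentially. c n m = a)"
    by (auto simp: recurrent_path_iff)
  then obtain N where "\<And>n. n \<ge> N \<Longrightarrow> c n m \<noteq> a"
    by (auto simp: frequently_def eventually_sequentially)
  from int_path_one_sided[of "\<lambda>n. c n m" N a, OF abs_step this] that show ?thesis
    by blast
qed

text \<open>The almost sure facts enter as the hypotheses \<open>meet\<close> and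
  \<open>fin\<close>, so the argument concerns one path only.\<close>

lemma not_above_if_recurrent:
  assumes meet: "\<And>m m'. m \<in> {1..k} \<Longrightarrow> m' \<in> {1..k} \<Longrightarrow> \<exists>\<^sub>F n in sequentially. c n m = c n m' \<Longrightarrow>
      recurrent_path (\<lambda>n. c n m) \<Longrightarrow> recurrent_path (\<lambda>n. c n m')"
    and fin: "\<And>m N a. m \<in> {1..k} \<Longrightarrow> (\<And>n. n \<ge> N \<Longrightarrow> a \<le> c n m) \<Longrightarrow> finite (fresh_right k c m)"
    and r: "r \<in> {1..k}" "recurrent_path (\<lambda>n. c n r)"
    and m: "m \<in> {1..k}"
  shows "\<not> (\<forall>n\<ge>N. c n m > a)"
proof
  assume above: "\<forall>n\<ge>N. c n m > a"
  \<comment> \<open>Every start lies on the left side of an edge \<open>j \<ge> B\<close>, so the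
    first crossing of such an edge is rightwards.\<close>
  define B where "B = Max (c 0 ` {1..k})"
  have B: "c 0 i \<le> B" if "i \<in> {1..k}" for i
    unfolding B_def using that by (intro Max_ge) auto
  have "j \<in> (\<Union>i\<in>{1..k}. (\<lambda>n. c n i) ` fresh_right k c i \<inter> {B..})" if j: "j \<in> {B..}" for j
  proof -
    from r(2) have "\<exists>n. c n r = j + 1"
      unfolding recurrent_path_iff by (blast dest: frequently_ex)
    then obtain n where n: "c n r = j + 1" ..
    have "path_crossings k c n j \<noteq> 0"
      using side_of_uncrossed_edge[OF r(1), of n j] B[OF r(1)] n j by auto
    from crossed_edge_fresh[OF this] obtain i where i: "i \<in> {1..k}"
      "j \<in> (\<lambda>n. c n i) ` fresh_right k c i \<union> (\<lambda>n. c n i - 1) ` fresh_left k c i" by blast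
    moreover have "j \<notin> (\<lambda>n. c n i - 1) ` fresh_left k c i"
      using fresh_left_less_start[OF i(1)] B[OF i(1)] j by force
    ultimately show ?thesis using j by blast
  qed
  then have "{B..} \<subseteq> (\<Union>i\<in>{1..k}. (\<lambda>n. c n i) ` fresh_right k c i \<inter> {B..})" by blast
  moreover have "infinite {B..}" by (rule infinite_Ici)
  ultimately have "infinite (\<Union>i\<in>{1..k}. (\<lambda>n. c n i) ` fresh_right k c i \<inter> {B..})"
    using finite_subset by blast
  then obtain i where i: "i \<in> {1..k}" and inf: "infinite ((\<lambda>n. c n i) ` fresh_right k c i \<inter> {B..})"
    by (meson finite_UN_I finite_atLeastAtMost)
  \<comment> \<open>Otherwise \<open>i\<close> would be one-sided: a lower bound contradicts
    \<open>fin\<close>, an upper bound contradicts \<open>finite_fresh_right_edges\<close>.\<close>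
  have rec_i: "recurrent_path (\<lambda>n. c n i)"
  proof (rule ccontr)
    assume "\<not> ?thesis"
    then show False
    proof (rule one_sided_if_not_recurrent)
      fix N a assume "\<forall>n\<ge>N. c n i > a"
      then have "finite (fresh_right k c i)" by (intro fin[OF i]) (auto intro: less_imp_le)
      with inf show False by auto
    next
      fix N a assume "\<forall>n\<ge>N. c n i < a"
      then have "finite ((\<lambda>n. c n i) ` fresh_right k c i)"
        by (intro finite_fresh_right_edges[OF i]) (auto intro: less_imp_le)
      with inf show False by auto
    qed
  qed
  have below: "\<exists>n\<ge>N'. c n i < c n m" for N'
  proof -
    from rec_i have "\<exists>n\<ge>max N N'. c n i = a"
      unfolding recurrent_path_iff frequently_sequentially by blast
    with above show ?thesis by auto
  qed
  have above': "\<exists>n\<ge>N'. c n m \<le> c n i" for N'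
  proof -
    \<comment> \<open>Infinitely many edges need infinitely many times, some of them later than
      \<open>N'\<close>.\<close>
    have "infinite {n \<in> fresh_right k c i. c n i \<ge> B}"
    proof
      assume "finite {n \<in> fresh_right k c i. c n i \<ge> B}"
      then have "finite ((\<lambda>n. c n i) ` {n \<in> fresh_right k c i. c n i \<ge> B})" by simp
      moreover have "(\<lambda>n. c n i) ` fresh_right k c i \<inter> {B..} \<subseteq>
          (\<lambda>n. c n i) ` {n \<in> fresh_right k c i. c n i \<ge> B}" by auto
      ultimately show False using inf finite_subset by blast
    qed
    then obtain n where "n \<ge> N'" "n \<in> fresh_right k c i" "c n i \<ge> B"
      unfolding infinite_nat_iff_unbounded_le by auto
    with fresh_right_start_le[OF i this(2) m] B[OF m] show ?thesis by auto
  qed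
  have "\<exists>\<^sub>F n in sequentially. c n i = c n m"
  proof (rule ccontr)
    assume "\<not> ?thesis"
    then obtain N' where "\<And>n. n \<ge> N' \<Longrightarrow> c n i - c n m \<noteq> 0"
      by (auto simp: frequently_def eventually_sequentially)
    from int_path_one_sided[of "\<lambda>n. c n i - c n m" N' 0, OF abs_step_diff this]
    have "(\<forall>n\<ge>N'. c n m < c n i) \<or> (\<forall>n\<ge>N'. c n i < c n m)" by simp
    then show False
    proof
      assume "\<forall>n\<ge>N'. c n i < c n m"
      with above'[of N'] show False by (meson not_le)
    qed (use below[of N'] in \<open>meson not_less_iff_gr_or_eq\<close>)
  qed
  from meet[OF i m this rec_i] have "\<exists>n\<ge>N. c n m = a"
    unfolding recurrent_path_iff frequently_sequentially by simp
  with above show False by auto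
qed

lemma finite_range_if_none_recurrent:
  assumes none: "\<And>m. m \<in> {1..k} \<Longrightarrow> \<not> recurrent_path (\<lambda>n. c n m)"
    and fin_right: "\<And>m N a. m \<in> {1..k} \<Longrightarrow> (\<And>n. n \<ge> N \<Longrightarrow> a \<le> c n m) \<Longrightarrow> finite (fresh_right k c m)"
    and fin_left: "\<And>m N a. m \<in> {1..k} \<Longrightarrow> (\<And>n. n \<ge> N \<Longrightarrow> c n m \<le> a) \<Longrightarrow> finite (fresh_left k c m)"
    and m: "m \<in> {1..k}"
  shows "finite_range_path (\<lambda>n. c n m)"
proof -
  interpret reflected: legal_path k "\<lambda>n m. - c n m" by (rule legal_path_reflect)
  \<comment> \<open>\<open>Z\<close> contains every edge that is ever crossed, so each position is
    the start or an end of an edge in \<open>Z\<close>.\<close>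
  define Z where "Z = (\<Union>i\<in>{1..k}.
    (\<lambda>n. c n i) ` fresh_right k c i \<union> (\<lambda>n. c n i - 1) ` fresh_left k c i)"
  have "finite ((\<lambda>n. c n i) ` fresh_right k c i) \<and> finite ((\<lambda>n. c n i - 1) ` fresh_left k c i)"
    if i: "i \<in> {1..k}" for i
    using none[OF i]
  proof (rule one_sided_if_not_recurrent)
    fix N a assume *: "\<forall>n\<ge>N. c n i > a"
    have "finite (fresh_right k c i)"
      using * by (intro fin_right[OF i]) (auto intro: less_imp_le)
    \<comment> \<open>Taken from the reflected path; the map \<open>- x - 1\<close> then turns its
      vertices back into the left fresh edges.\<close>
    moreover have "finite ((\<lambda>n. - c n i) ` fresh_left k c i)"
      using reflected.finite_fresh_right_edges[OF i, of N "- a"] *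
      by (auto simp: fresh_right_reflect intro: less_imp_le)
    then have "finite ((\<lambda>x. - x - 1) ` (\<lambda>n. - c n i) ` fresh_left k c i)" by (rule finite_imageI)
    ultimately show ?thesis by (simp add: image_image)
  next
    fix N a assume *: "\<forall>n\<ge>N. c n i < a"
    have "finite (fresh_left k c i)"
      using * by (intro fin_left[OF i]) (auto intro: less_imp_le)
    moreover have "finite ((\<lambda>n. c n i) ` fresh_right k c i)"
      using * by (intro finite_fresh_right_edges[OF i]) (auto intro: less_imp_le)
    ultimately show ?thesis by simp
  qed
  then have "finite Z" unfolding Z_def by blast
  have "c n m \<in> insert (c 0 m) (Z \<union> (\<lambda>j. j + 1) ` Z)" for n
  proof (induction n)
    case (Suc n)
    show ?case
    proof (cases "c (Suc n) m = c n m")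
      case False
      define j where "j = min (c n m) (c (Suc n) m)"
      have j: "{c n m, c (Suc n) m} = {j, j + 1}"
        using abs_step[of n m] False by (auto simp: j_def min_def)
      then have "m \<in> {m \<in> {1..k}. {c n m, c (Suc n) m} = {j, j + 1}}" using m by simp
      then have "card {m \<in> {1..k}. {c n m, c (Suc n) m} = {j, j + 1}} \<noteq> 0"
        by (subst card_0_eq) auto
      then have "path_crossings k c (Suc n) j \<noteq> 0"
        by (simp add: crossings_Suc)
      from crossed_edge_fresh[OF this] have "j \<in> Z" unfolding Z_def by blast
      moreover from j have "c (Suc n) m \<in> {j, j + 1}" by blast
      ultimately show ?thesis by auto
    qed (use Suc in simp)
  qed simp
  then have "range (\<lambda>n. c n m) \<subseteq> insert (c 0 m) (Z \<union> (\<lambda>j. j + 1) ` Z)" by blast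
  with \<open>finite Z\<close> show ?thesis
    unfolding finite_range_path_def by (meson finite_UnI finite_imageI finite_insert finite_subset)
qed

lemma all_recurrent_or_all_finite_range:
  assumes meet: "\<And>m m'. m \<in> {1..k} \<Longrightarrow> m' \<in> {1..k} \<Longrightarrow> \<exists>\<^sub>F n in sequentially. c n m = c n m' \<Longrightarrow>
      recurrent_path (\<lambda>n. c n m) \<Longrightarrow> recurrent_path (\<lambda>n. c n m')"
    and fin_right: "\<And>m N a. m \<in> {1..k} \<Longrightarrow> (\<And>n. n \<ge> N \<Longrightarrow> a \<le> c n m) \<Longrightarrow> finite (fresh_right k c m)"
    and fin_left: "\<And>m N a. m \<in> {1..k} \<Longrightarrow> (\<And>n. n \<ge> N \<Longrightarrow> c n m \<le> a) \<Longrightarrow> finite (fresh_left k c m)"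
  shows "(\<forall>m\<in>{1..k}. recurrent_path (\<lambda>n. c n m)) \<or> (\<forall>m\<in>{1..k}. finite_range_path (\<lambda>n. c n m))"
proof (cases "\<exists>r\<in>{1..k}. recurrent_path (\<lambda>n. c n r)")
  case True
  then obtain r where r: "r \<in> {1..k}" "recurrent_path (\<lambda>n. c n r)" by blast
  interpret reflected: legal_path k "\<lambda>n m. - c n m" by (rule legal_path_reflect)
  have "recurrent_path (\<lambda>n. c n m)" if m: "m \<in> {1..k}" for m
  proof (rule ccontr)
    assume "\<not> ?thesis"
    then show False
    proof (rule one_sided_if_not_recurrent)
      fix N a assume "\<forall>n\<ge>N. c n m > a"
      moreover have "\<not> (\<forall>n\<ge>N. c n m > a)"
        by (rule not_above_if_recurrent[OF _ _ r m]) (use meet fin_right in blast)+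
      ultimately show False by blast
    next
      fix N a assume below: "\<forall>n\<ge>N. c n m < a"
      have "\<not> (\<forall>n\<ge>N. - c n m > - a)"
      proof (rule reflected.not_above_if_recurrent[OF _ _ r(1) _ m])
        fix m N a assume "m \<in> {1..k}" "\<And>n. n \<ge> N \<Longrightarrow> a \<le> - c n m"
        then show "finite (fresh_right k (\<lambda>n m. - c n m) m)"
          unfolding fresh_right_reflect by (intro fin_left[of m N "- a"]) force+
      qed (use meet r(2) in \<open>simp_all add: recurrent_path_reflect\<close>)
      with below show False by auto
    qed
  qed
  then show ?thesis by blast
next
  case False
  have "finite_range_path (\<lambda>n. c n m)" if "m \<in> {1..k}" for m
    by (rule finite_range_if_none_recurrent[OF _ _ _ that]) (use False fin_right fin_left in blast)+
  then show ?thesis by blast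
qed

end

section \<open>The law of the path\<close>

lemma integral_bind_pmf_finite:
  fixes f :: "'b \<Rightarrow> real"
  assumes "finite (set_pmf p)" "\<And>x. x \<in> set_pmf p \<Longrightarrow> finite (set_pmf (g x))"
  shows "measure_pmf.expectation (bind_pmf p g) f =
    measure_pmf.expectation p (\<lambda>x. measure_pmf.expectation (g x) f)"
  using assms
  by (subst pmf_expectation_bind[of "set_pmf p"])
     (auto simp: integral_measure_pmf[of "set_pmf p"])

lemma finite_set_step_law: "k \<ge> 1 \<Longrightarrow> finite (set_pmf (step_law k v x))"
  unfolding step_law_def by (auto simp: set_pmf_of_set)

lemma step_law_legal: "k \<ge> 1 \<Longrightarrow> y \<in> set_pmf (step_law k v x) \<Longrightarrow> legal_step k x y"
  unfolding step_law_def legal_step_def by (auto simp: set_pmf_of_set split: if_splits)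

text \<open>\<open>step_law\<close> carries along the coordinates outside \<open>{1..k}\<close>,
  where \<open>X\<close> is arbitrary; setting them to 0 commutes with a step.\<close>

lemma map_restrict_step_law:
  fixes x :: "nat \<Rightarrow> int"
  assumes "k \<ge> 1"
  defines "\<rho> \<equiv> \<lambda>x m. if m \<in> {1..k} then x m else 0"
  shows "map_pmf \<rho> (step_law k v x) = step_law k v (\<rho> x)"
proof -
  have "\<rho> (x(m := if r then x m + 1 else x m - 1)) =
      (\<rho> x)(m := if r then (\<rho> x) m + 1 else (\<rho> x) m - 1)" if "m \<in> {1..k}" for m r
    using that by (auto simp: \<rho>_def fun_eq_iff)
  moreover have "\<rho> x m = x m" if "m \<in> {1..k}" for m
    using that by (simp add: \<rho>_def)
  ultimately show ?thesis
    unfolding step_law_def map_bind_pmf map_pmf_comp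
    using assms(1) by (intro bind_pmf_cong refl map_pmf_cong) (auto simp: set_pmf_of_set)
qed

text \<open>Turns the event of \<open>transition\<close>, which constrains only
  \<open>{1..k}\<close>, into a point mass: it is the preimage of one configuration under zeroing
  the other coordinates.\<close>

lemma prob_step_law_agree:
  assumes k: "k \<ge> 1" and x: "\<And>m. m \<in> {1..k} \<Longrightarrow> x m = x' m" "\<And>m. m \<notin> {1..k} \<Longrightarrow> x' m = 0"
    and y: "\<And>m. m \<notin> {1..k} \<Longrightarrow> y m = (0::int)"
  shows "measure_pmf.prob (step_law k v x) {z. \<forall>m\<in>{1..k}. z m = y m} = pmf (step_law k v x') y"
proof -
  define \<rho> :: "(nat \<Rightarrow> int) \<Rightarrow> nat \<Rightarrow> int" where "\<rho> = (\<lambda>x m. if m \<in> {1..k} then x m else 0)"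
  have "x' = \<rho> x"
    using x by (auto simp: \<rho>_def fun_eq_iff)
  moreover have "{z. \<forall>m\<in>{1..k}. z m = y m} = \<rho> -` {y}"
    using y by (auto simp: \<rho>_def fun_eq_iff)
  moreover have "pmf (step_law k v (\<rho> x)) y = measure_pmf.prob (step_law k v x) (\<rho> -` {y})"
    unfolding \<rho>_def map_restrict_step_law[OF k, symmetric] by (rule pmf_map)
  ultimately show ?thesis
    by simp
qed

section \<open>Finite-horizon path laws\<close>

text \<open>Padding gives paths of every horizon the same type, so functionals of infinite paths
  apply to them directly.\<close>

definition stop_path :: "nat \<Rightarrow> (nat \<Rightarrow> nat \<Rightarrow> int) \<Rightarrow> nat \<Rightarrow> nat \<Rightarrow> int" where
  "stop_path n c i = (if i \<le> n then c i else (\<lambda>_. 0))"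

abbreviation path_weight ::
  "nat \<Rightarrow> (int \<Rightarrow> nat \<Rightarrow> real) \<Rightarrow> (nat \<Rightarrow> nat \<Rightarrow> int) \<Rightarrow> nat \<Rightarrow> int \<Rightarrow> real" where
  "path_weight k W c n j \<equiv> weight k W (\<lambda>m i c. c i m) n j c"

definition next_law ::
  "nat \<Rightarrow> (int \<Rightarrow> nat \<Rightarrow> real) \<Rightarrow> (nat \<Rightarrow> nat \<Rightarrow> int) \<Rightarrow> nat \<Rightarrow> (nat \<Rightarrow> int) pmf" where
  "next_law k W c n = step_law k (path_weight k W c n) (c n)"

text \<open>
  The law of the path up to time \<open>n\<close>, with all later positions set to \<open>0\<close>; so are the positions
  of the irrelevant walkers outside \<open>{1..k}\<close>.
\<close>

primrec path_pmf ::
  "nat \<Rightarrow> (int \<Rightarrow> nat \<Rightarrow> real) \<Rightarrow> (nat \<Rightarrow> int) \<Rightarrow> nat \<Rightarrow> (nat \<Rightarrow> nat \<Rightarrow> int) pmf" where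
  "path_pmf k W x0 0 = return_pmf (stop_path 0 (\<lambda>_ m. if m \<in> {1..k} then x0 m else 0))"
| "path_pmf k W x0 (Suc n) =
     bind_pmf (path_pmf k W x0 n) (\<lambda>h. map_pmf (\<lambda>y. h(Suc n := y)) (next_law k W h n))"

lemma stop_path_Suc: "stop_path (Suc n) c = (stop_path n c)(Suc n := c (Suc n))"
  by (auto simp: stop_path_def fun_eq_iff)

lemma path_pmf_zero_after: "h \<in> set_pmf (path_pmf k W x0 n) \<Longrightarrow> i > n \<Longrightarrow> h i = (\<lambda>_. 0)"
  by (induction n arbitrary: h) (auto simp: stop_path_def)

lemma path_pmf_irrelevant:
  assumes "k \<ge> 1" "h \<in> set_pmf (path_pmf k W x0 n)" "m \<notin> {1..k}"
  shows "h i m = 0"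
  using assms(2)
proof (induction n arbitrary: h i)
  case (Suc n)
  then obtain h' y where h': "h' \<in> set_pmf (path_pmf k W x0 n)" "h = h'(Suc n := y)"
    "y \<in> set_pmf (next_law k W h' n)"
    by auto
  have "legal_step k (h' n) y"
    using h'(3) assms(1) unfolding next_law_def by (rule step_law_legal[rotated])
  then have "y m = h' n m"
    using assms(3) by (auto simp: legal_step_def)
  with Suc.IH[OF h'(1)] h'(2) show ?case
    by simp
qed (use assms(3) in \<open>auto simp: stop_path_def\<close>)

lemma path_pmf_legal:
  assumes "k \<ge> 1" "h \<in> set_pmf (path_pmf k W x0 (Suc n))"
  shows "legal_step k (h n) (h (Suc n))"
  using assms step_law_legal[OF assms(1)] by (auto simp: next_law_def)

lemma finite_set_path_pmf: "k \<ge> 1 \<Longrightarrow> finite (set_pmf (path_pmf k W x0 n))"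
  by (induction n) (auto simp: next_law_def finite_set_step_law)

lemma expectation_path_pmf_Suc:
  fixes f :: "(nat \<Rightarrow> nat \<Rightarrow> int) \<Rightarrow> real"
  assumes "k \<ge> 1"
  shows "measure_pmf.expectation (path_pmf k W x0 (Suc n)) f =
    measure_pmf.expectation (path_pmf k W x0 n)
      (\<lambda>h. measure_pmf.expectation (next_law k W h n) (\<lambda>y. f (h(Suc n := y))))"
  unfolding path_pmf.simps
  by (subst integral_bind_pmf_finite)
     (simp_all add: finite_set_path_pmf[OF assms] finite_set_step_law[OF assms] next_law_def)

text \<open>The padding determines the predecessor of \<open>h\<close>, namely \<open>h\<close> with
  entry \<open>Suc n\<close> reset to 0, so only one term of the mixture survives.\<close>

lemma pmf_path_pmf_Suc:
  "pmf (path_pmf k W x0 (Suc n)) h =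
     pmf (path_pmf k W x0 n) (h(Suc n := (\<lambda>_. 0))) *
     pmf (next_law k W (h(Suc n := (\<lambda>_. 0))) n) (h (Suc n))"
proof -
  let ?P = "path_pmf k W x0 n" and ?h0 = "h(Suc n := (\<lambda>_. 0))"
  have "pmf (path_pmf k W x0 (Suc n)) h =
    (\<integral>h'. pmf (map_pmf (\<lambda>y. h'(Suc n := y)) (next_law k W h' n)) h \<partial>?P)"
    by (simp add: pmf_bind)
  also have "\<dots> = (\<integral>h'. indicator {?h0} h' * pmf (next_law k W ?h0 n) (h (Suc n)) \<partial>?P)"
  proof (intro integral_cong_AE AE_pmfI)
    fix h' assume "h' \<in> set_pmf ?P"
    then have 0: "h' (Suc n) = (\<lambda>_. 0)" by (rule path_pmf_zero_after) simp
    show "pmf (map_pmf (\<lambda>y. h'(Suc n := y)) (next_law k W h' n)) h =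
      indicator {?h0} h' * pmf (next_law k W ?h0 n) (h (Suc n))"
    proof (cases "h' = ?h0")
      case True
      have "(\<lambda>y. h'(Suc n := y)) -` {h} = {h (Suc n)}"
        unfolding True by (auto simp: fun_upd_idem_iff)
      with True show ?thesis
        by (simp add: pmf_map measure_pmf_single)
    next
      case False
      moreover have "h = h'(Suc n := y) \<Longrightarrow> h' = ?h0" for y
        using 0 by (simp add: fun_upd_idem)
      ultimately have "(\<lambda>y. h'(Suc n := y)) -` {h} = {}"
        by blast
      with False show ?thesis
        by (simp add: pmf_map)
    qed
  qed auto
  also have "\<dots> = pmf ?P ?h0 * pmf (next_law k W ?h0 n) (h (Suc n))"
    by (simp add: measure_pmf_single)
  finally show ?thesis .
qed

section \<open>The law of the walkers under \<open>M\<close>\<close>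

context edge_reinforced_walkers
begin

definition path :: "'a \<Rightarrow> nat \<Rightarrow> nat \<Rightarrow> int" where
  "path \<omega> n m = (if m \<in> {1..k} then X m n \<omega> else 0)"

lemma weight_eq_path_weight: "weight k W X n j \<omega> = path_weight k W (path \<omega>) n j"
  unfolding weight_def by (intro arg_cong[of _ _ "W j"] crossings_cong) (simp add: path_def)

lemma path_weight_cong:
  assumes "\<And>m i. m \<in> {1..k} \<Longrightarrow> i \<le> n \<Longrightarrow> c i m = c' i m"
  shows "path_weight k W c n j = path_weight k W c' n j"
  unfolding weight_def using assms by (intro arg_cong[of _ _ "W j"] crossings_cong)

text \<open>A finite product of countable discrete spaces is discrete, so every function of the path
  up to time \<open>n\<close> is measurable.\<close>

lemma measurable_stop_path: "(\<lambda>\<omega>. stop_path n (path \<omega>)) \<in> measurable M (count_space UNIV)"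
proof -
  define S where "S = {..n} \<times> {1..k}"
  define G :: "(nat \<times> nat \<Rightarrow> int) \<Rightarrow> nat \<Rightarrow> nat \<Rightarrow> int" where
    "G = (\<lambda>g i m. if i \<le> n \<and> m \<in> {1..k} then g (i, m) else 0)"
  have "(\<lambda>\<omega>. \<lambda>p\<in>S. X (snd p) (fst p) \<omega>) \<in> measurable M (PiM S (\<lambda>_. count_space (UNIV :: int set)))"
    by (rule measurable_restrict) (auto simp: S_def intro: walker_measurable)
  also have "PiM S (\<lambda>_. count_space (UNIV :: int set)) = count_space (PiE S (\<lambda>_. UNIV))"
    by (rule count_space_PiM_finite) (auto simp: S_def)
  finally have "(\<lambda>\<omega>. G (\<lambda>p\<in>S. X (snd p) (fst p) \<omega>)) \<in> measurable M (count_space UNIV)"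
    by (rule measurable_compose) simp
  also have "(\<lambda>\<omega>. G (\<lambda>p\<in>S. X (snd p) (fst p) \<omega>)) = (\<lambda>\<omega>. stop_path n (path \<omega>))"
    by (auto simp: G_def S_def stop_path_def path_def fun_eq_iff)
  finally show ?thesis .
qed

lemma measurable_path_fun:
  assumes "\<And>c c'. (\<And>i. i \<le> n \<Longrightarrow> c i = c' i) \<Longrightarrow> f c = f c'"
  shows "(\<lambda>\<omega>. f (path \<omega>)) \<in> measurable M (count_space UNIV)"
proof -
  have "(\<lambda>\<omega>. f (stop_path n (path \<omega>))) \<in> measurable M (count_space UNIV)"
    by (rule measurable_compose[OF measurable_stop_path]) simp
  also have "(\<lambda>\<omega>. f (stop_path n (path \<omega>))) = (\<lambda>\<omega>. f (path \<omega>))"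
    by (intro ext assms) (simp add: stop_path_def)
  finally show ?thesis .
qed

lemma space_history: "space (history M k W X n) = space M"
  unfolding history_def by (rule space_measure_of) auto

lemma sets_history: "sets (history M k W X n) = sigma_sets (space M)
     ({X m i -` A \<inter> space M | m i A. m \<in> {1..k} \<and> i \<le> n} \<union>
      {weight k W X i j -` B \<inter> space M | i j B. i \<le> n \<and> B \<in> sets borel})"
  unfolding history_def by (rule sets_measure_of) auto

lemma subalgebra_history: "subalgebra M (history M k W X n)"
proof -
  have "X m i -` A \<inter> space M \<in> sets M" if "m \<in> {1..k}" for m i A
    using measurable_sets[OF walker_measurable[OF that]] by simp
  moreover have "weight k W X i j -` B \<inter> space M \<in> sets M" if "B \<in> sets borel" for i j B
  proof -
    have "weight k W X i j = (\<lambda>\<omega>. path_weight k W (path \<omega>) i j)"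
      by (simp add: weight_eq_path_weight fun_eq_iff)
    also have "\<dots> \<in> measurable M (count_space UNIV)"
      by (rule measurable_path_fun[of i]) (auto intro: path_weight_cong)
    finally show ?thesis by (rule measurable_sets) simp
  qed
  ultimately show ?thesis
    unfolding subalgebra_def space_history sets_history
    by (auto intro!: sets.sigma_sets_subset)
qed

lemma path_eq_event_in_history:
  "{\<omega> \<in> space M. stop_path n (path \<omega>) = h} \<in> sets (history M k W X n)"
proof (cases "{\<omega> \<in> space M. stop_path n (path \<omega>) = h} = {}")
  case False
  \<comment> \<open>The witness shows that \<open>h\<close> vanishes wherever padding forces it to,
    so that equality with \<open>h\<close> amounts to finitely many conditions on
    \<open>X\<close>.\<close>
  then obtain \<omega>0 where \<omega>0: "stop_path n (path \<omega>0) = h" by blast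
  have "{\<omega> \<in> space M. stop_path n (path \<omega>) = h} =
      {\<omega> \<in> space M. \<forall>i\<in>{..n}. \<forall>m\<in>{1..k}. X m i \<omega> = h i m}"
    unfolding \<omega>0[symmetric] by (auto simp: stop_path_def path_def fun_eq_iff)
  also have "\<dots> = {\<omega> \<in> space (history M k W X n). \<forall>i\<in>{..n}. \<forall>m\<in>{1..k}. X m i \<omega> = h i m}"
    by (simp add: space_history)
  also have "\<dots> \<in> sets (history M k W X n)"
  proof (intro sets.sets_Collect_finite_All)
    fix i m assume "i \<in> {..n}" "m \<in> {1..k}"
    then have "X m i -` {h i m} \<inter> space M \<in> sets (history M k W X n)"
      unfolding sets_history by (intro sigma_sets.Basic) blast
    also have "X m i -` {h i m} \<inter> space M = {\<omega> \<in> space (history M k W X n). X m i \<omega> = h i m}"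
      by (auto simp: space_history)
    finally show "{\<omega> \<in> space (history M k W X n). X m i \<omega> = h i m} \<in> sets (history M k W X n)" .
  qed auto
  finally show ?thesis .
next
  case True
  then show ?thesis by (simp only: sets.empty_sets)
qed

lemma prob_stop_path_eq: "prob {\<omega> \<in> space M. stop_path n (path \<omega>) = h} = pmf (path_pmf k W x0 n) h"
proof (induction n arbitrary: h)
  case 0
  have "AE \<omega> in M. \<forall>m\<in>{1..k}. X m 0 \<omega> = x0 m"
    using initial_position by (intro AE_finite_allI) auto
  then have "AE \<omega> in M. stop_path 0 (path \<omega>) = stop_path 0 (\<lambda>_ m. if m \<in> {1..k} then x0 m else 0)"
    (is "AE \<omega> in M. _ = ?h")
    by (rule eventually_mono) (auto simp: stop_path_def path_def fun_eq_iff)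
  then have "AE \<omega> in M. stop_path 0 (path \<omega>) = h \<longleftrightarrow> ?h = h"
    by (rule eventually_mono) auto
  then have "prob {\<omega> \<in> space M. stop_path 0 (path \<omega>) = h} = prob {\<omega> \<in> space M. ?h = h}"
    using measurable_stop_path[of 0, THEN measurable_sets, of "{h}"]
    by (intro measure_eq_AE) (auto simp: vimage_def Int_def conj_commute)
  also have "\<dots> = pmf (path_pmf k W x0 0) h"
    by (auto simp: prob_space indicator_def)
  finally show ?case .
next
  case (Suc n)
  define h0 where "h0 = h(Suc n := (\<lambda>_. 0))"
  define y where "y = h (Suc n)"
  define A where "A = {\<omega> \<in> space M. stop_path n (path \<omega>) = h0}"
  define B where "B = {\<omega> \<in> space M. \<forall>m\<in>{1..k}. X m (Suc n) \<omega> = y m}"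
  let ?F = "history M k W X n"
  have IH: "prob A = pmf (path_pmf k W x0 n) h0"
    unfolding A_def by (rule Suc.IH)
  have split: "stop_path (Suc n) (path \<omega>) = h \<longleftrightarrow>
      stop_path n (path \<omega>) = h0 \<and> path \<omega> (Suc n) = y" for \<omega>
    unfolding stop_path_Suc h0_def y_def by (auto simp: fun_eq_iff stop_path_def)
  have "prob {\<omega> \<in> space M. stop_path (Suc n) (path \<omega>) = h} = prob A * pmf (next_law k W h0 n) y"
  proof (cases "\<forall>m. m \<notin> {1..k} \<longrightarrow> y m = 0")
    case True
    have eq: "{\<omega> \<in> space M. stop_path (Suc n) (path \<omega>) = h} = A \<inter> B"
      unfolding split A_def B_def using True by (auto simp: path_def fun_eq_iff)
    interpret F: finite_measure_subalgebra M ?F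
      by unfold_locales (rule subalgebra_history)
    have AF: "A \<in> sets ?F"
      unfolding A_def by (rule path_eq_event_in_history)
    then have [measurable]: "A \<in> sets M"
      using subalgebra_history by (auto simp: subalgebra_def)
    have [measurable]: "B \<in> sets M"
      unfolding B_def
    proof (intro sets.sets_Collect_finite_All)
      fix m assume "m \<in> {1..k}"
      from measurable_sets[OF walker_measurable[OF this], of "{y m}" "Suc n"]
      show "{\<omega> \<in> space M. X m (Suc n) \<omega> = y m} \<in> events"
        by (simp add: vimage_def Int_def conj_commute)
    qed simp
    have "prob (A \<inter> B) = (\<integral>\<omega>\<in>A. indicator B \<omega> \<partial>M)"
      unfolding set_lebesgue_integral_def by (simp add: indicator_inter_arith[symmetric])
    \<comment> \<open>\<open>A\<close> lies in the history, so the indicator of \<open>B\<close> may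
      be replaced by its conditional expectation. This is almost everywhere constant on
      \<open>A\<close>, because \<open>A\<close> fixes the whole past.\<close>
    also have "\<dots> = (\<integral>\<omega>\<in>A. real_cond_exp M ?F (indicator B) \<omega> \<partial>M)"
      by (rule F.real_cond_exp_intA[OF _ AF]) (auto simp: emeasure_eq_measure)
    also have "\<dots> = (\<integral>\<omega>\<in>A. pmf (next_law k W h0 n) y \<partial>M)"
      unfolding set_lebesgue_integral_def
    proof (intro integral_cong_AE)
      show "AE \<omega> in M. indicator A \<omega> *\<^sub>R real_cond_exp M ?F (indicator B) \<omega> =
          indicator A \<omega> *\<^sub>R pmf (next_law k W h0 n) y"
        using transition[of n y]
      proof eventually_elim
        case (elim \<omega>)
        show ?case
        proof (cases "\<omega> \<in> A")
          case True
          then have h0: "stop_path n (path \<omega>) = h0" by (simp add: A_def)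
          have "weight k W X n j \<omega> = path_weight k W h0 n j" for j
            unfolding weight_eq_path_weight h0[symmetric]
            by (rule path_weight_cong) (simp add: stop_path_def)
          then have "real_cond_exp M ?F (indicator B) \<omega> = measure_pmf.prob
              (step_law k (path_weight k W h0 n) (\<lambda>m. X m n \<omega>)) {x. \<forall>m\<in>{1..k}. x m = y m}"
            using elim by (simp add: B_def)
          also have "\<dots> = pmf (next_law k W h0 n) y"
            unfolding next_law_def
            by (rule prob_step_law_agree[OF at_least_one_walker])
               (use \<open>\<forall>m. m \<notin> {1..k} \<longrightarrow> y m = 0\<close> in
                 \<open>auto simp: h0[symmetric] stop_path_def path_def\<close>)
          finally show ?thesis by simp
        qed simp
      qed
    qed auto
    also have "\<dots> = prob A * pmf (next_law k W h0 n) y"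
      unfolding set_lebesgue_integral_def by simp
    finally show ?thesis unfolding eq .
  next
    case False
    then obtain m where m: "m \<notin> {1..k}" "y m \<noteq> 0" by blast
    have "{\<omega> \<in> space M. stop_path (Suc n) (path \<omega>) = h} = {}"
      unfolding split using m by (auto simp: path_def)
    \<comment> \<open>A legal step never moves an irrelevant walker away from 0, so the right side
      vanishes as well.\<close>
    moreover have "pmf (path_pmf k W x0 n) h0 * pmf (next_law k W h0 n) y = 0"
    proof (rule ccontr)
      assume "\<not> ?thesis"
      then have "h0 \<in> set_pmf (path_pmf k W x0 n)" "legal_step k (h0 n) y"
        using step_law_legal[OF at_least_one_walker] by (auto simp: set_pmf_iff next_law_def)
      with path_pmf_irrelevant[OF at_least_one_walker _ m(1)] m show False
        by (auto simp: legal_step_def)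
    qed
    ultimately show ?thesis unfolding IH by (simp only: measure_empty)
  qed
  then show ?case
    unfolding IH pmf_path_pmf_Suc h0_def y_def .
qed

text \<open>Point masses give agreement on finite sets. As the finite support of
  \<open>path_pmf\<close> has full probability, any set can be cut down to a finite one.\<close>

lemma distr_stop_path:
  "distr M (count_space UNIV) (\<lambda>\<omega>. stop_path n (path \<omega>)) = measure_pmf (path_pmf k W x0 n)"
proof (rule measure_eqI)
  fix A :: "(nat \<Rightarrow> nat \<Rightarrow> int) set"
  let ?P = "path_pmf k W x0 n"
  let ?f = "\<lambda>\<omega>. stop_path n (path \<omega>)"
  have [measurable]: "{\<omega> \<in> space M. ?f \<omega> \<in> B} \<in> events" for B
    using measurable_sets[OF measurable_stop_path, of B n] by (simp add: vimage_def Int_def conj_commute)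
  have fin: "prob {\<omega> \<in> space M. ?f \<omega> \<in> B} = measure_pmf.prob ?P B" if "finite B" for B
  proof -
    have "prob {\<omega> \<in> space M. ?f \<omega> \<in> B} = prob (\<Union>h\<in>B. {\<omega> \<in> space M. ?f \<omega> = h})"
      by (rule arg_cong[of _ _ prob]) auto
    also have "\<dots> = (\<Sum>h\<in>B. prob {\<omega> \<in> space M. ?f \<omega> = h})"
    proof (rule measure_finite_Union[OF that])
      show "(\<lambda>h. {\<omega> \<in> space M. ?f \<omega> = h}) ` B \<subseteq> events"
      proof safe
        fix h
        show "{\<omega> \<in> space M. ?f \<omega> = h} \<in> events"
          using \<open>\<And>B. {\<omega> \<in> space M. ?f \<omega> \<in> B} \<in> events\<close>[of "{h}"] by simp
      qed
    qed (auto simp: disjoint_family_on_def emeasure_eq_measure)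
    also have "\<dots> = measure_pmf.prob ?P B"
      by (simp add: prob_stop_path_eq measure_measure_pmf_finite[OF that])
    finally show ?thesis .
  qed
  have fin_supp: "finite (set_pmf ?P)"
    by (rule finite_set_path_pmf[OF at_least_one_walker])
  have "prob {\<omega> \<in> space M. ?f \<omega> \<in> set_pmf ?P} = 1"
    unfolding fin[OF fin_supp] by (simp add: measure_pmf.prob_eq_1 AE_measure_pmf)
  then have "AE \<omega> in M. ?f \<omega> \<in> set_pmf ?P"
    by (subst (asm) prob_eq_1) auto
  then have "prob {\<omega> \<in> space M. ?f \<omega> \<in> A} = prob {\<omega> \<in> space M. ?f \<omega> \<in> A \<inter> set_pmf ?P}"
    by (intro measure_eq_AE) auto
  also have "\<dots> = measure_pmf.prob ?P A"
    using fin_supp by (subst fin) (auto simp: measure_Int_set_pmf)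
  finally show "emeasure (distr M (count_space UNIV) ?f) A = emeasure ?P A"
    by (subst emeasure_distr[OF measurable_stop_path])
       (auto simp: emeasure_eq_measure measure_pmf.emeasure_eq_measure vimage_def Int_def conj_commute)
qed simp

lemma expectation_path:
  fixes f :: "(nat \<Rightarrow> nat \<Rightarrow> int) \<Rightarrow> real"
  assumes "\<And>c c'. (\<And>i. i \<le> n \<Longrightarrow> c i = c' i) \<Longrightarrow> f c = f c'"
  shows "expectation (\<lambda>\<omega>. f (path \<omega>)) = measure_pmf.expectation (path_pmf k W x0 n) f"
    and "integrable M (\<lambda>\<omega>. f (path \<omega>))"
proof -
  have eq: "(\<lambda>\<omega>. f (path \<omega>)) = (\<lambda>\<omega>. f (stop_path n (path \<omega>)))"
    by (intro ext assms) (simp add: stop_path_def)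
  show "expectation (\<lambda>\<omega>. f (path \<omega>)) = measure_pmf.expectation (path_pmf k W x0 n) f"
    unfolding distr_stop_path[symmetric] eq by (subst integral_distr[OF measurable_stop_path]) auto
  have "integrable (path_pmf k W x0 n) f"
    by (intro integrable_measure_pmf_finite finite_set_path_pmf at_least_one_walker)
  then show "integrable M (\<lambda>\<omega>. f (path \<omega>))"
    unfolding distr_stop_path[symmetric] eq
    by (subst (asm) integrable_distr_eq[OF measurable_stop_path]) auto
qed

lemma AE_path_legal: "AE \<omega> in M. \<forall>n. legal_step k (path \<omega> n) (path \<omega> (Suc n))"
proof (subst AE_all_countable, rule allI)
  fix n
  have "AE h in distr M (count_space UNIV) (\<lambda>\<omega>. stop_path (Suc n) (path \<omega>)).
      legal_step k (h n) (h (Suc n))"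
    unfolding distr_stop_path
    by (rule AE_pmfI) (rule path_pmf_legal[OF at_least_one_walker])
  from AE_distrD[OF measurable_stop_path this]
  show "AE \<omega> in M. legal_step k (path \<omega> n) (path \<omega> (Suc n))"
    by (simp add: stop_path_def)
qed

end

section \<open>The martingale of a single walker\<close>

context edge_reinforced_walkers
begin

text \<open>
  Reinforcement lowers the resistance \<open>1 / w\<close> of the edges. Recording a rightward crossing with the
  resistance before the crossing, instead of after it, turns the resulting supermartingale into the
  martingale with the following increments.
\<close>

definition increment :: "nat \<Rightarrow> (nat \<Rightarrow> nat \<Rightarrow> int) \<Rightarrow> nat \<Rightarrow> real" where
  "increment m c n =
     (if c (Suc n) m = c n m + 1 then 1 / path_weight k W c n (c n m)
      else if c (Suc n) m = c n m - 1 then - 1 / path_weight k W c n (c n m - 1)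
      else 0)"

lemma weight_pos: "path_weight k W c n j > 0"
  unfolding weight_def by (rule weight_function_pos)

lemma increment_cong:
  assumes "\<And>i. i \<le> Suc n \<Longrightarrow> c i = c' i"
  shows "increment m c n = increment m c' n"
proof -
  have "path_weight k W c n j = path_weight k W c' n j" for j
    by (rule path_weight_cong) (simp add: assms)
  with assms[of n] assms[of "Suc n"] show ?thesis
    by (simp add: increment_def)
qed

text \<open>The probability of crossing an edge is proportional to its weight and the gain is the
  reciprocal weight, so the two directions cancel. If another walker is chosen, the increment is
  0.\<close>

lemma expectation_increment:
  "measure_pmf.expectation (next_law k W h n) (\<lambda>y. increment m (h(Suc n := y)) n) = 0"
proof -
  define v where "v = path_weight k W h n"
  define \<phi> where "\<phi> z = (if z = h n m + 1 then 1 / v (h n m)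
      else if z = h n m - 1 then - 1 / v (h n m - 1) else 0)" for z
  have v: "v j > 0" for j
    unfolding v_def by (rule weight_pos)
  have w: "path_weight k W (h(Suc n := y)) n j = v j" for y j
    unfolding v_def by (rule path_weight_cong) simp
  have "measure_pmf.expectation (bernoulli_pmf (v (h n i) / (v (h n i - 1) + v (h n i))))
      (\<lambda>right. \<phi> (((h n)(i := if right then h n i + 1 else h n i - 1)) m)) = 0" for i
  proof -
    let ?p = "v (h n i) / (v (h n i - 1) + v (h n i))"
    have *: "v (h n i - 1) + v (h n i) > 0"
      using v by (intro add_pos_pos)
    then have "0 \<le> ?p" "?p \<le> 1"
      using v[of "h n i"] v[of "h n i - 1"] by (auto simp: field_simps)
    moreover have "1 - ?p = v (h n i - 1) / (v (h n i - 1) + v (h n i))"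
      using * by (simp add: field_simps)
    then have "(1 - ?p) / v (h n i - 1) = ?p / v (h n i)"
      using v[of "h n i"] v[of "h n i - 1"] by simp
    ultimately show ?thesis
      by (auto simp: \<phi>_def)
  qed
  then have "measure_pmf.expectation (step_law k v (h n)) (\<lambda>y. \<phi> (y m)) = 0"
    unfolding step_law_def using at_least_one_walker
    by (subst integral_bind_pmf_finite) (auto simp: set_pmf_of_set)
  moreover have "increment m (h(Suc n := y)) n = \<phi> (y m)" for y
    by (simp add: increment_def \<phi>_def w)
  ultimately show ?thesis
    by (simp add: next_law_def v_def[symmetric])
qed

section \<open>The stopped martingale and its squares\<close>

text \<open>A martingale transform with the first exit from \<open>[-K, L]\<close> built into the
  recursion in place of a stopping time. The sign \<open>s\<close> is 1 for walkers staying to the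
  right and -1 for those staying to the left.\<close>

primrec stopped_sum ::
  "real \<Rightarrow> real \<Rightarrow> real \<Rightarrow> nat \<Rightarrow> (nat \<Rightarrow> nat \<Rightarrow> int) \<Rightarrow> nat \<Rightarrow> real" where
  "stopped_sum s K L m c 0 = 0"
| "stopped_sum s K L m c (Suc n) = stopped_sum s K L m c n +
     (if stopped_sum s K L m c n \<in> {-K..L} then s * increment m c n else 0)"

text \<open>This is the squared step of \<open>stopped_sum\<close>, so its partial sums are the
  quadratic variation.\<close>

definition stopped_square ::
  "real \<Rightarrow> real \<Rightarrow> real \<Rightarrow> nat \<Rightarrow> (nat \<Rightarrow> nat \<Rightarrow> int) \<Rightarrow> nat \<Rightarrow> real" where
  "stopped_square s K L m c n =
     (if stopped_sum s K L m c n \<in> {-K..L} then (s * increment m c n)\<^sup>2 else 0)"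

lemma stopped_sum_cong:
  "(\<And>i. i \<le> n \<Longrightarrow> c i = c' i) \<Longrightarrow> stopped_sum s K L m c n = stopped_sum s K L m c' n"
proof (induction n)
  case (Suc n)
  then have "stopped_sum s K L m c n = stopped_sum s K L m c' n"
    "increment m c n = increment m c' n"
    by (auto intro: increment_cong)
  then show ?case by simp
qed simp

lemma stopped_square_cong:
  assumes "\<And>i. i \<le> Suc n \<Longrightarrow> c i = c' i"
  shows "stopped_square s K L m c n = stopped_square s K L m c' n"
  using stopped_sum_cong[of n c c' s K L m] increment_cong[of n c c' m] assms
  by (simp add: stopped_square_def)

lemma sum_stopped_square_cong:
  "(\<And>i. i \<le> n \<Longrightarrow> c i = c' i) \<Longrightarrow>
    (\<Sum>i<n. stopped_square s K L m c i) = (\<Sum>i<n. stopped_square s K L m c' i)"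
  by (intro sum.cong stopped_square_cong) auto

lemma integrable_next_law:
  fixes f :: "(nat \<Rightarrow> int) \<Rightarrow> real"
  shows "integrable (next_law k W h n) f"
  unfolding next_law_def
  by (intro integrable_measure_pmf_finite finite_set_step_law at_least_one_walker)

lemma expectation_stopped_sum:
  "measure_pmf.expectation (path_pmf k W x0 n) (\<lambda>c. stopped_sum s K L m c n) = 0"
proof (induction n)
  case (Suc n)
  have "measure_pmf.expectation (next_law k W h n) (\<lambda>y. stopped_sum s K L m (h(Suc n := y)) (Suc n))
      = stopped_sum s K L m h n" for h
  proof -
    have *: "stopped_sum s K L m (h(Suc n := y)) n = stopped_sum s K L m h n" for y
      by (rule stopped_sum_cong) simp
    \<comment> \<open>Whether the sum is frozen is decided by the path up to time \<open>n\<close>,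
      so the factor \<open>?a\<close> leaves the expectation.\<close>
    let ?a = "if stopped_sum s K L m h n \<in> {-K..L} then s else 0"
    have "stopped_sum s K L m (h(Suc n := y)) (Suc n) =
        stopped_sum s K L m h n + ?a * increment m (h(Suc n := y)) n" for y
      by (simp add: *)
    then show ?thesis
      by (simp only: Bochner_Integration.integral_add integrable_next_law
          Bochner_Integration.integral_mult_right expectation_increment) simp
  qed
  with Suc.IH show ?case
    by (simp only: expectation_path_pmf_Suc[OF at_least_one_walker])
qed simp

text \<open>Square minus quadratic variation is a martingale: the new square cancels, and the cross
  term is a known factor times an increment of mean 0.\<close>

lemma expectation_stopped_sum_square:
  "measure_pmf.expectation (path_pmf k W x0 n)
     (\<lambda>c. (stopped_sum s K L m c n)\<^sup>2 - (\<Sum>i<n. stopped_square s K L m c i)) = 0"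
proof (induction n)
  case (Suc n)
  have "measure_pmf.expectation (next_law k W h n)
        (\<lambda>y. (stopped_sum s K L m (h(Suc n := y)) (Suc n))\<^sup>2 -
             (\<Sum>i<Suc n. stopped_square s K L m (h(Suc n := y)) i))
      = (stopped_sum s K L m h n)\<^sup>2 - (\<Sum>i<n. stopped_square s K L m h i)" for h
  proof -
    let ?T = "stopped_sum s K L m h n"
    let ?S = "\<Sum>i<n. stopped_square s K L m h i"
    let ?a = "if ?T \<in> {-K..L} then 2 * ?T * s else 0"
    have T: "stopped_sum s K L m (h(Suc n := y)) n = ?T" for y
      by (rule stopped_sum_cong) simp
    have S: "(\<Sum>i<n. stopped_square s K L m (h(Suc n := y)) i) = ?S" for y
      by (rule sum_stopped_square_cong) simp
    have "(stopped_sum s K L m (h(Suc n := y)) (Suc n))\<^sup>2 -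
             (\<Sum>i<Suc n. stopped_square s K L m (h(Suc n := y)) i) =
          (?T\<^sup>2 - ?S) + ?a * increment m (h(Suc n := y)) n" for y
      unfolding sum.lessThan_Suc stopped_sum.simps stopped_square_def[of s K L m "h(Suc n := y)" n] T S
      by (simp add: power2_sum algebra_simps)
    then show ?thesis
      by (simp only: Bochner_Integration.integral_add integrable_next_law
          Bochner_Integration.integral_mult_right expectation_increment) simp
  qed
  with Suc.IH show ?case
    by (simp only: expectation_path_pmf_Suc[OF at_least_one_walker])
qed simp

text \<open>Weights never drop below their initial values, so every resistance is at most the
  largest initial one, a maximum over 1 and finitely many exceptional edges.\<close>

lemma increment_bounded:
  assumes "finite {j. W j 0 \<noteq> 1}"
  obtains C where "C > 0" "\<And>m c n. \<bar>increment m c n\<bar> \<le> C"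
proof -
  define C where "C = Max (insert 1 ((\<lambda>j. 1 / W j 0) ` {j. W j 0 \<noteq> 1}))"
  have fin: "finite (insert 1 ((\<lambda>j. 1 / W j 0) ` {j. W j 0 \<noteq> 1}))"
    using assms by simp
  have "1 \<le> C"
    unfolding C_def using fin by (rule Max_ge) simp
  have C0: "1 / W j 0 \<le> C" for j
    unfolding C_def using fin by (rule Max_ge) (cases "W j 0 = 1"; auto)
  have C: "1 / path_weight k W c n j \<le> C" for c n j
  proof -
    have "W j 0 \<le> path_weight k W c n j"
      unfolding weight_def by (intro monoD[OF weight_function_mono]) simp
    then have "1 / path_weight k W c n j \<le> 1 / W j 0"
      using weight_function_pos[of j 0] by (intro divide_left_mono) (auto intro: mult_pos_pos weight_pos)
    with C0 show ?thesis by (rule order_trans[rotated])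
  qed
  have "\<bar>increment m c n\<bar> \<le> C" for m c n
    using C \<open>1 \<le> C\<close> less_imp_le[OF weight_pos]
    by (simp add: increment_def abs_of_pos weight_pos)
  with \<open>1 \<le> C\<close> show ?thesis
    by (intro that[of C]) auto
qed

text \<open>A step is taken only from within \<open>[-K, L]\<close>, so the overshoot is at most one
  increment.\<close>

lemma stopped_sum_bounds:
  assumes "\<And>m c n. \<bar>increment m c n\<bar> \<le> C" "s \<in> {1, -1}" "K \<ge> 0" "L \<ge> 0"
  shows "stopped_sum s K L m c n \<in> {-K-C..L+C}"
proof (induction n)
  case 0
  have "0 \<le> C" using assms(1)[of 0 "\<lambda>_ _. 0" 0] by simp
  with assms(3,4) show ?case by simp
next
  case (Suc n)
  have "\<bar>s * increment m c n\<bar> \<le> C"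
    using assms(1)[of m c n] assms(2) by auto
  with Suc show ?case by auto
qed

lemma measurable_stopped_sum:
  "(\<lambda>\<omega>. stopped_sum s K L m (path \<omega>) n) \<in> borel_measurable M"
  using expectation_path(2)[where f = "\<lambda>c. stopped_sum s K L m c n", OF stopped_sum_cong]
  by (rule borel_measurable_integrable)

lemma measurable_stopped_square:
  "(\<lambda>\<omega>. stopped_square s K L m (path \<omega>) n) \<in> borel_measurable M"
  using expectation_path(2)[where f = "\<lambda>c. stopped_square s K L m c n", OF stopped_square_cong]
  by (rule borel_measurable_integrable)

text \<open>Markov's inequality for the nonnegative variable \<open>?T n + K + C\<close>, of mean
  \<open>K + C\<close>. Once above \<open>L\<close> the sum is frozen, so the events increase with
  \<open>n\<close> and the bound passes to their union.\<close>

lemma prob_exceeds_le: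
  assumes "C > 0" "\<And>m c n. \<bar>increment m c n\<bar> \<le> C" "s \<in> {1, -1}" "K \<ge> 0" "L > 0"
  shows "prob {\<omega> \<in> space M. \<exists>n. stopped_sum s K L m (path \<omega>) n > L} \<le> (K + C) / L"
proof -
  let ?T = "\<lambda>n \<omega>. stopped_sum s K L m (path \<omega>) n"
  let ?E = "\<lambda>n. {\<omega> \<in> space M. ?T n \<omega> > L}"
  note [measurable] = measurable_stopped_sum
  have bounds: "?T n \<omega> \<in> {-K-C..L+C}" for n \<omega>
    using assms by (intro stopped_sum_bounds) auto
  have E: "prob (?E n) \<le> (K + C) / L" for n
  proof -
    have "L * prob (?E n) = (\<integral>\<omega>. L * indicator (?E n) \<omega> \<partial>M)"
      by (simp add: Int_absorb2)
    also have "\<dots> \<le> (\<integral>\<omega>. ?T n \<omega> + (K + C) \<partial>M)"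
    proof (rule integral_mono)
      fix \<omega> assume "\<omega> \<in> space M"
      show "L * indicator (?E n) \<omega> \<le> ?T n \<omega> + (K + C)"
        using bounds[of \<omega> n] assms(1,4) by (auto simp: indicator_def)
    qed (auto intro!: expectation_path(2) stopped_sum_cong integrable_real_mult_indicator
        simp: emeasure_eq_measure)
    also have "\<dots> = K + C"
      using expectation_path[where f = "\<lambda>c. stopped_sum s K L m c n" and n = n, OF stopped_sum_cong]
      by (simp add: expectation_stopped_sum prob_space)
    finally show ?thesis
      using assms(5) by (simp add: field_simps)
  qed
  have "incseq ?E"
  proof (rule incseq_SucI, safe)
    fix n \<omega> assume "?T n \<omega> > L"
    then show "?T (Suc n) \<omega> > L" by simp
  qed
  then have "(\<lambda>n. prob (?E n)) \<longlonglongrightarrow> prob (\<Union>n. ?E n)"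
    by (intro finite_Lim_measure_incseq) auto
  then have "prob (\<Union>n. ?E n) \<le> (K + C) / L"
    by (rule LIMSEQ_le_const2) (use E in blast)
  also have "(\<Union>n. ?E n) = {\<omega> \<in> space M. \<exists>n. ?T n \<omega> > L}"
    by auto
  finally show ?thesis .
qed

text \<open>The expected partial sums equal second moments of the stopped sum, hence are at most
  \<open>B\<close>; so the infinite sum has finite expectation.\<close>

lemma AE_summable_stopped_square:
  assumes "\<And>m c n. \<bar>increment m c n\<bar> \<le> C" "s \<in> {1, -1}" "K \<ge> 0" "L \<ge> 0"
  shows "AE \<omega> in M. summable (\<lambda>n. stopped_square s K L m (path \<omega>) n)"
proof -
  let ?T = "\<lambda>n \<omega>. stopped_sum s K L m (path \<omega>) n"
  let ?q = "\<lambda>n \<omega>. stopped_square s K L m (path \<omega>) n"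
  define B where "B = (K + L + C)\<^sup>2"
  note [measurable] = measurable_stopped_square
  have int_q: "integrable M (?q n)" for n
    by (rule expectation_path(2)[of "Suc n"]) (rule stopped_square_cong)
  have "0 \<le> C" using assms(1)[of 0 "\<lambda>_ _. 0" 0] by simp
  have sum_le: "(\<Sum>i<n. expectation (?q i)) \<le> B" for n
  proof -
    let ?f = "\<lambda>c. (stopped_sum s K L m c n)\<^sup>2 - (\<Sum>i<n. stopped_square s K L m c i)"
    have f: "expectation (\<lambda>\<omega>. ?f (path \<omega>)) = 0" "integrable M (\<lambda>\<omega>. ?f (path \<omega>))"
      using expectation_path[where f = ?f and n = n]
      by (auto simp: expectation_stopped_sum_square cong: stopped_sum_cong sum_stopped_square_cong)
    have "(\<Sum>i<n. expectation (?q i)) = expectation (\<lambda>\<omega>. \<Sum>i<n. ?q i \<omega>)"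
      by (simp add: int_q)
    also have "\<dots> \<le> expectation (\<lambda>\<omega>. B - ?f (path \<omega>))"
    proof (rule integral_mono)
      fix \<omega>
      have "\<bar>?T n \<omega>\<bar> \<le> K + L + C"
        using stopped_sum_bounds[OF assms, of m "path \<omega>" n] assms(3,4) by auto
      then have "(?T n \<omega>)\<^sup>2 \<le> B"
        unfolding B_def using \<open>0 \<le> C\<close> assms(3,4) by (intro abs_le_square_iff[THEN iffD1]) auto
      then show "(\<Sum>i<n. ?q i \<omega>) \<le> B - ?f (path \<omega>)" by simp
    qed (use f int_q in auto)
    also have "\<dots> = B"
      using f by (simp add: prob_space)
    finally show ?thesis .
  qed
  have nonneg: "?q n \<omega> \<ge> 0" for n \<omega>
    by (simp add: stopped_square_def)
  have "(\<integral>\<^sup>+\<omega>. (\<Sum>n. ennreal (?q n \<omega>)) \<partial>M) = (\<Sum>n. \<integral>\<^sup>+\<omega>. ennreal (?q n \<omega>) \<partial>M)"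
    by (rule nn_integral_suminf) measurable
  also have "\<dots> = (\<Sum>n. ennreal (expectation (?q n)))"
    by (intro suminf_cong nn_integral_eq_integral int_q) (simp add: nonneg)
  also have "\<dots> \<le> ennreal B"
  proof (rule suminf_le_const)
    fix n
    have "(\<Sum>i<n. ennreal (expectation (?q i))) = ennreal (\<Sum>i<n. expectation (?q i))"
      by (rule sum_ennreal) (simp add: nonneg)
    also have "\<dots> \<le> ennreal B"
      by (intro ennreal_leI sum_le)
    finally show "(\<Sum>i<n. ennreal (expectation (?q i))) \<le> ennreal B" .
  qed simp
  finally have "(\<integral>\<^sup>+\<omega>. (\<Sum>n. ennreal (?q n \<omega>)) \<partial>M) \<noteq> \<infinity>"
    by (auto simp: top_unique)
  then have "AE \<omega> in M. (\<Sum>n. ennreal (?q n \<omega>)) \<noteq> \<infinity>"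
    by (intro nn_integral_PInf_AE) auto
  then show ?thesis
    by (rule eventually_mono) (auto intro!: summable_suminf_not_top nonneg)
qed

text \<open>Under the lower bound the sum can be frozen only by exceeding \<open>L\<close>. Almost
  surely some level is never exceeded, and for it the stopped squares are the full squares.\<close>

lemma AE_summable_increments:
  assumes "finite {j. W j 0 \<noteq> 1}" and s: "s \<in> {1, -1}" and K: "K \<ge> 0"
  shows "AE \<omega> in M. (\<forall>n. s * (\<Sum>i<n. increment m (path \<omega>) i) \<ge> -K) \<longrightarrow>
    summable (\<lambda>i. (increment m (path \<omega>) i)\<^sup>2)"
proof -
  obtain C where C: "C > 0" "\<And>m c n. \<bar>increment m c n\<bar> \<le> C"
    using increment_bounded[OF assms(1)] by metis
  let ?L = "\<lambda>l. real (Suc l)"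
  let ?T = "\<lambda>l n \<omega>. stopped_sum s K (?L l) m (path \<omega>) n"
  let ?V = "\<lambda>l. {\<omega> \<in> space M. \<exists>n. ?T l n \<omega> > ?L l}"
  note [measurable] = measurable_stopped_sum
  have V: "?V l \<in> events" for l by measurable
  have "prob (\<Inter>l. ?V l) \<le> 0"
  proof (rule LIMSEQ_le_const)
    show "(\<lambda>l. (K + C) / ?L l) \<longlonglongrightarrow> 0"
      by (rule LIMSEQ_Suc[OF lim_const_over_n])
    have "prob (\<Inter>l. ?V l) \<le> (K + C) / ?L l" for l
    proof -
      have "prob (\<Inter>l. ?V l) \<le> prob (?V l)"
        by (rule finite_measure_mono[OF _ V]) blast
      also have "\<dots> \<le> (K + C) / ?L l"
        using C s K by (intro prob_exceeds_le) auto
      finally show ?thesis .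
    qed
    then show "\<exists>N. \<forall>l\<ge>N. prob (\<Inter>l. ?V l) \<le> (K + C) / ?L l" by blast
  qed
  then have "(\<Inter>l. ?V l) \<in> null_sets M"
    using V by (intro null_setsI) (auto simp: emeasure_eq_measure measure_le_0_iff)
  then have "AE \<omega> in M. \<omega> \<notin> (\<Inter>l. ?V l)"
    by (rule AE_not_in)
  moreover have "AE \<omega> in M. \<forall>l. summable (\<lambda>n. stopped_square s K (?L l) m (path \<omega>) n)"
    using C s K by (subst AE_all_countable) (auto intro!: AE_summable_stopped_square)
  moreover have "AE \<omega> in M. \<omega> \<in> space M" by (rule AE_space)
  ultimately show ?thesis
  proof eventually_elim
    case (elim \<omega>)
    show ?case
    proof
      assume lower: "\<forall>n. s * (\<Sum>i<n. increment m (path \<omega>) i) \<ge> -K"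
      from elim(1,3) obtain l where l: "\<And>n. ?T l n \<omega> \<le> ?L l"
        by (auto simp: not_less)
      have T: "?T l n \<omega> = s * (\<Sum>i<n. increment m (path \<omega>) i)" for n
      proof (induction n)
        case (Suc n)
        have "?T l n \<omega> \<in> {-K..?L l}"
          using lower l[of n] unfolding Suc by simp
        with Suc show ?case by (simp add: distrib_left)
      qed simp
      have "?T l n \<omega> \<in> {-K..?L l}" for n
        using lower l[of n] unfolding T by simp
      then have eq: "stopped_square s K (?L l) m (path \<omega>) = (\<lambda>i. (increment m (path \<omega>) i)\<^sup>2)"
        using s by (auto simp: stopped_square_def fun_eq_iff)
      from elim(2) have "summable (stopped_square s K (?L l) m (path \<omega>))" ..
      then show "summable (\<lambda>i. (increment m (path \<omega>) i)\<^sup>2)"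
        unfolding eq .
    qed
  qed
qed

end

section \<open>Finitely many fresh edges on one side\<close>

context edge_reinforced_walkers
begin

lemma inverse_weight_antimono:
  "n \<le> n' \<Longrightarrow> 1 / path_weight k W c n' j \<le> 1 / path_weight k W c n j"
  unfolding weight_def
  by (intro divide_left_mono monoD[OF weight_function_mono] crossings_mono)
     (auto intro!: mult_pos_pos weight_function_pos)

text \<open>The left side compares resistances between \<open>a\<close> and the walker. At fixed
  weights a move changes the resistance by exactly the increment; updating the weights afterwards
  can only lower it.\<close>

lemma sum_increment_right:
  assumes step: "\<And>n. \<bar>c (Suc n) m - c n m\<bar> \<le> 1"
    and side: "\<And>n. n \<ge> N \<Longrightarrow> a \<le> c n m" and "N \<le> n"
  shows "(\<Sum>j\<in>{a..<c n m}. 1 / path_weight k W c n j) - (\<Sum>j\<in>{a..<c N m}. 1 / path_weight k W c N j)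
    \<le> (\<Sum>i\<in>{N..<n}. increment m c i)"
  using assms(3)
proof (induction rule: dec_induct)
  case (step n)
  let ?w = "path_weight k W c"
  have "(\<Sum>j\<in>{a..<c (Suc n) m}. 1 / ?w (Suc n) j) \<le> (\<Sum>j\<in>{a..<c (Suc n) m}. 1 / ?w n j)"
    by (intro sum_mono inverse_weight_antimono) simp
  also have "\<dots> = (\<Sum>j\<in>{a..<c n m}. 1 / ?w n j) + increment m c n"
  proof -
    consider "c (Suc n) m = c n m" | "c (Suc n) m = c n m + 1" | "c n m = c (Suc n) m + 1"
      using assms(1)[of n] by linarith
    then show ?thesis
    proof cases
      case 2
      then have "{a..<c (Suc n) m} = insert (c n m) {a..<c n m}"
        using side[of n] step by auto
      with 2 show ?thesis by (simp add: increment_def)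
    next
      case 3
      then have "{a..<c n m} = insert (c (Suc n) m) {a..<c (Suc n) m}"
        using side[of "Suc n"] step by auto
      with 3 show ?thesis by (simp add: increment_def)
    qed (simp add: increment_def)
  qed
  finally show ?case
    using step by simp
qed simp

text \<open>Proved directly, since reflecting the path would also replace \<open>W\<close> by a
  reflected weight function.\<close>

lemma sum_increment_left:
  assumes step: "\<And>n. \<bar>c (Suc n) m - c n m\<bar> \<le> 1"
    and side: "\<And>n. n \<ge> N \<Longrightarrow> c n m \<le> a" and "N \<le> n"
  shows "(\<Sum>j\<in>{c n m..<a}. 1 / path_weight k W c n j) - (\<Sum>j\<in>{c N m..<a}. 1 / path_weight k W c N j)
    \<le> - (\<Sum>i\<in>{N..<n}. increment m c i)"
  using assms(3)
proof (induction rule: dec_induct)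
  case (step n)
  let ?w = "path_weight k W c"
  have "(\<Sum>j\<in>{c (Suc n) m..<a}. 1 / ?w (Suc n) j) \<le> (\<Sum>j\<in>{c (Suc n) m..<a}. 1 / ?w n j)"
    by (intro sum_mono inverse_weight_antimono) simp
  also have "\<dots> = (\<Sum>j\<in>{c n m..<a}. 1 / ?w n j) - increment m c n"
  proof -
    consider "c (Suc n) m = c n m" | "c (Suc n) m = c n m + 1" | "c n m = c (Suc n) m + 1"
      using assms(1)[of n] by linarith
    then show ?thesis
    proof cases
      case 2
      then have "{c n m..<a} = insert (c n m) {c (Suc n) m..<a}"
        using side[of "Suc n"] step by auto
      with 2 show ?thesis by (simp add: increment_def)
    next
      case 3
      then have "{c (Suc n) m..<a} = insert (c (Suc n) m) {c n m..<a}"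
        using side[of n] step by auto
      with 3 show ?thesis by (simp add: increment_def)
    qed (simp add: increment_def)
  qed
  finally show ?case
    using step by simp
qed simp

text \<open>Resistances are nonnegative, so after time \<open>N\<close> the signed sum loses at most
  the resistance at time \<open>N\<close>. The bound is a natural number so that one almost sure
  statement can range over all bounds.\<close>

lemma increments_one_sided:
  assumes step: "\<And>n. \<bar>c (Suc n) m - c n m\<bar> \<le> 1"
    and side: "(s = 1 \<and> (\<forall>n\<ge>N. a \<le> c n m)) \<or> (s = -1 \<and> (\<forall>n\<ge>N. c n m \<le> a))"
  shows "\<exists>K::nat. \<forall>n. s * (\<Sum>i<n. increment m c i) \<ge> - real K"
proof -
  let ?S = "\<lambda>n. \<Sum>i<n. increment m c i"
  have "\<exists>B\<ge>0. \<forall>n\<ge>N. - B \<le> s * (\<Sum>i\<in>{N..<n}. increment m c i)"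
    using side
  proof (elim disjE conjE)
    assume "s = 1" "\<forall>n\<ge>N. a \<le> c n m"
    let ?R = "\<lambda>n. \<Sum>j\<in>{a..<c n m}. 1 / path_weight k W c n j"
    have nonneg: "?R n \<ge> 0" for n
      by (intro sum_nonneg) (auto intro: less_imp_le weight_pos)
    have "- ?R N \<le> 1 * (\<Sum>i\<in>{N..<n}. increment m c i)" if "n \<ge> N" for n
    proof -
      have "?R n - ?R N \<le> (\<Sum>i\<in>{N..<n}. increment m c i)"
        using \<open>\<forall>n\<ge>N. a \<le> c n m\<close> that by (intro sum_increment_right step) auto
      with nonneg[of n] show ?thesis by linarith
    qed
    with nonneg[of N] show ?thesis
      unfolding \<open>s = 1\<close> by blast
  next
    assume "s = -1" "\<forall>n\<ge>N. c n m \<le> a"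
    let ?R = "\<lambda>n. \<Sum>j\<in>{c n m..<a}. 1 / path_weight k W c n j"
    have nonneg: "?R n \<ge> 0" for n
      by (intro sum_nonneg) (auto intro: less_imp_le weight_pos)
    have "- ?R N \<le> -1 * (\<Sum>i\<in>{N..<n}. increment m c i)" if "n \<ge> N" for n
    proof -
      have "?R n - ?R N \<le> - (\<Sum>i\<in>{N..<n}. increment m c i)"
        using \<open>\<forall>n\<ge>N. c n m \<le> a\<close> that by (intro sum_increment_left step) auto
      with nonneg[of n] show ?thesis by linarith
    qed
    with nonneg[of N] show ?thesis
      unfolding \<open>s = -1\<close> by blast
  qed
  then obtain B where B: "B \<ge> 0" "\<And>n. n \<ge> N \<Longrightarrow> - B \<le> s * (\<Sum>i\<in>{N..<n}. increment m c i)"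
    by blast
  \<comment> \<open>\<open>B\<close> bounds the loss after \<open>N\<close>; the sum bounds every
    partial sum up to and including the one at \<open>N\<close>.\<close>
  define K where "K = B + (\<Sum>n\<le>N. \<bar>s * ?S n\<bar>)"
  have early: "\<bar>s * ?S n\<bar> \<le> (\<Sum>n\<le>N. \<bar>s * ?S n\<bar>)" if "n \<le> N" for n
    using that by (intro member_le_sum) auto
  have "s * ?S n \<ge> - K" for n
  proof (cases "n \<ge> N")
    case True
    then have "?S n = ?S N + (\<Sum>i\<in>{N..<n}. increment m c i)"
      by (metis atLeast0LessThan le0 sum.atLeastLessThan_concat)
    then have "s * ?S n = s * ?S N + s * (\<Sum>i\<in>{N..<n}. increment m c i)"
      by (simp add: distrib_left)
    with B(2)[OF True] early[of N] show ?thesis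
      unfolding K_def by linarith
  next
    case False
    with early[of n] B(1) show ?thesis
      unfolding K_def by linarith
  qed
  moreover have "K \<le> real (nat \<lceil>K\<rceil>)" by linarith
  ultimately show ?thesis
    by (intro exI[of _ "nat \<lceil>K\<rceil>"] allI) (meson neg_le_iff_le order_trans)
qed

text \<open>A fresh edge has its initial weight, at most \<open>C\<close>, so the increment has
  modulus at least \<open>1 / C\<close>, while the terms of a convergent series tend to 0.\<close>

lemma finite_fresh_if_summable:
  assumes fin: "finite {j. W j 0 \<noteq> 1}" and summ: "summable (\<lambda>i. (increment m c i)\<^sup>2)"
  shows "finite (fresh_right k c m)" "finite (fresh_left k c m)"
proof -
  define C where "C = Max (insert 1 ((\<lambda>j. W j 0) ` {j. W j 0 \<noteq> 1}))"
  have fin': "finite (insert 1 ((\<lambda>j. W j 0) ` {j. W j 0 \<noteq> 1}))"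
    using fin by simp
  have "C > 0"
    using Max_ge[OF fin', of 1] by (simp add: C_def)
  have C: "W j 0 \<le> C" for j
    unfolding C_def using fin' by (rule Max_ge) (cases "W j 0 = 1"; auto)
  have "(1 / C)\<^sup>2 \<le> (1 / W j 0)\<^sup>2" for j
    using C[of j] weight_function_pos[of j 0] \<open>C > 0\<close>
    by (intro power_mono divide_left_mono) auto
  then have ge: "fresh_right k c m \<union> fresh_left k c m \<subseteq> {i. (1 / C)\<^sup>2 \<le> (increment m c i)\<^sup>2}"
    by (auto simp: fresh_right_def fresh_left_def increment_def weight_def)
  have "(\<lambda>i. (increment m c i)\<^sup>2) \<longlonglongrightarrow> 0"
    using summ by (rule summable_LIMSEQ_zero)
  then have "\<forall>\<^sub>F i in sequentially. (increment m c i)\<^sup>2 < (1 / C)\<^sup>2"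
    by (rule order_tendstoD(2)) (use \<open>C > 0\<close> in simp)
  then have "finite {i. (1 / C)\<^sup>2 \<le> (increment m c i)\<^sup>2}"
    unfolding cofinite_eq_sequentially[symmetric] eventually_cofinite by (simp add: not_less)
  with ge show "finite (fresh_right k c m)" "finite (fresh_left k c m)"
    by (auto intro: finite_subset)
qed

text \<open>\<open>N\<close> and \<open>a\<close> may depend on the path. They enter only through
  \<open>K\<close> and \<open>s\<close>, which range over countable sets, so one null set serves
  all.\<close>

lemma AE_finite_fresh:
  assumes "finite {j. W j 0 \<noteq> 1}"
  shows "AE \<omega> in M. \<forall>m N a. (\<forall>n\<ge>N. a \<le> path \<omega> n m) \<or> (\<forall>n\<ge>N. path \<omega> n m \<le> a) \<longrightarrow>
    finite (fresh_right k (path \<omega>) m) \<and> finite (fresh_left k (path \<omega>) m)"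
proof -
  have "AE \<omega> in M. \<forall>m. \<forall>K::nat. \<forall>s\<in>{1, -1}. (\<forall>n. s * (\<Sum>i<n. increment m (path \<omega>) i) \<ge> - real K) \<longrightarrow>
      summable (\<lambda>i. (increment m (path \<omega>) i)\<^sup>2)"
    unfolding AE_all_countable
    by (intro allI AE_finite_allI AE_summable_increments assms) auto
  with AE_path_legal show ?thesis
  proof eventually_elim
    case (elim \<omega>)
    interpret legal_path k "path \<omega>"
      by unfold_locales (use elim in blast)
    show ?case
    proof (intro allI impI)
      fix m N a
      assume "(\<forall>n\<ge>N. a \<le> path \<omega> n m) \<or> (\<forall>n\<ge>N. path \<omega> n m \<le> a)"
      then have "\<exists>s\<in>{1, -1}. \<exists>K::nat. \<forall>n. s * (\<Sum>i<n. increment m (path \<omega>) i) \<ge> - real K"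
        using increments_one_sided[of "path \<omega>" m 1 N a, OF abs_step]
          increments_one_sided[of "path \<omega>" m "-1" N a, OF abs_step] by blast
      with elim(2) have "summable (\<lambda>i. (increment m (path \<omega>) i)\<^sup>2)" by blast
      from finite_fresh_if_summable[OF assms this]
      show "finite (fresh_right k (path \<omega>) m) \<and> finite (fresh_left k (path \<omega>) m)" ..
    qed
  qed
qed

end

section \<open>Exchanging two walkers\<close>

text \<open>The labels are swapped for good after the first meeting at time \<open>N\<close> or
  later. The value at time \<open>n\<close> looks at \<open>c\<close> up to time \<open>n\<close>
  only.\<close>

definition exchange :: "nat \<Rightarrow> nat \<Rightarrow> nat \<Rightarrow> (nat \<Rightarrow> nat \<Rightarrow> int) \<Rightarrow> nat \<Rightarrow> nat \<Rightarrow> int" where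
  "exchange a b N c n =
     (if \<exists>i. N \<le> i \<and> i < n \<and> c i a = c i b then c n \<circ> Transposition.transpose a b else c n)"

lemma exchange_before: "n \<le> N \<Longrightarrow> exchange a b N c n = c n"
  by (auto simp: exchange_def)

lemma comp_transpose_id: "x a = x b \<Longrightarrow> x \<circ> Transposition.transpose a b = x"
  by (auto simp: fun_eq_iff Transposition.transpose_def)

text \<open>At the meeting time itself the exchange has no effect, so \<open>i < n\<close> may be relaxed to \<open>i \<le> n\<close>.\<close>

lemma exchange_alt:
  "exchange a b N c n =
     (if \<exists>i. N \<le> i \<and> i < Suc n \<and> c i a = c i b then c n \<circ> Transposition.transpose a b else c n)"
  by (auto simp: exchange_def less_Suc_eq comp_transpose_id)

lemma exchange_meet: "exchange a b N c n a = exchange a b N c n b \<longleftrightarrow> c n a = c n b"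
  by (auto simp: exchange_def)

lemma card_transpose_eq:
  assumes "a \<in> {1..k}" "b \<in> {1..k::nat}"
  shows "card {m \<in> {1..k}. P (Transposition.transpose a b m)} = card {m \<in> {1..k}. P m}"
proof -
  have "{m \<in> {1..k}. P m} = Transposition.transpose a b ` {m \<in> {1..k}. P (Transposition.transpose a b m)}"
  proof (intro set_eqI iffI)
    fix m assume "m \<in> {m \<in> {1..k}. P m}"
    then have "Transposition.transpose a b m \<in> {m \<in> {1..k}. P (Transposition.transpose a b m)}"
      using assms by (auto simp: Transposition.transpose_def)
    then show "m \<in> Transposition.transpose a b ` {m \<in> {1..k}. P (Transposition.transpose a b m)}"
      by (metis image_eqI transpose_involutory)
  qed (use assms in \<open>auto simp: Transposition.transpose_def split: if_splits\<close>)
  then show ?thesis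
    by (simp add: card_image)
qed

text \<open>Crossings count all walkers alike, and by \<open>exchange_alt\<close> both ends of a
  step are permuted in the same way, even for the step that leaves the meeting.\<close>

lemma path_crossings_exchange:
  assumes "a \<in> {1..k}" "b \<in> {1..k}"
  shows "path_crossings k (exchange a b N c) n j = path_crossings k c n j"
proof (induction n)
  case (Suc n)
  let ?P = "\<lambda>m. {c n m, c (Suc n) m} = {j, j + 1}"
  have "card {m \<in> {1..k}. {exchange a b N c n m, exchange a b N c (Suc n) m} = {j, j + 1}} =
      card {m \<in> {1..k}. ?P m}"
  proof (cases "\<exists>i. N \<le> i \<and> i < Suc n \<and> c i a = c i b")
    case True
    then have "exchange a b N c n = c n \<circ> Transposition.transpose a b"
      "exchange a b N c (Suc n) = c (Suc n) \<circ> Transposition.transpose a b"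
      by (simp_all only: exchange_alt[of _ _ _ _ n] exchange_def[of _ _ _ _ "Suc n"] if_True)
    then show ?thesis
      using card_transpose_eq[OF assms, of ?P] by simp
  next
    case False
    then have "exchange a b N c n = c n" "exchange a b N c (Suc n) = c (Suc n)"
      by (simp_all only: exchange_alt[of _ _ _ _ n] exchange_def[of _ _ _ _ "Suc n"] if_False)
    then show ?thesis by simp
  qed
  with Suc show ?case
    by (simp add: crossings_Suc)
qed simp

text \<open>The uniform choice of the walker is invariant under relabelling, and the jump depends
  only on the chosen position and on \<open>v\<close>.\<close>

lemma step_law_transpose:
  assumes "a \<in> {1..k}" "b \<in> {1..k}"
  shows "step_law k v (x \<circ> Transposition.transpose a b) = map_pmf (\<lambda>y. y \<circ> Transposition.transpose a b) (step_law k v x)"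
proof -
  let ?t = "Transposition.transpose a b"
  define g where "g m = map_pmf (\<lambda>right. x(m := if right then x m + 1 else x m - 1) \<circ> ?t)
      (bernoulli_pmf (v (x m) / (v (x m - 1) + v (x m))))" for m
  have "?t ` {1..k} = {1..k}"
    using assms by (intro transpose_image_eq) auto
  moreover have "{1..k} \<noteq> {}"
    using assms by auto
  ultimately have "map_pmf ?t (pmf_of_set {1..k}) = pmf_of_set {1..k}"
    by (subst map_pmf_of_set_inj) (auto intro: inj_on_subset[OF inj_transpose])
  moreover have upd: "(x \<circ> ?t)(m := z) = x(?t m := z) \<circ> ?t" for m z
    by (auto simp: fun_eq_iff Transposition.transpose_def)
  have "step_law k v (x \<circ> ?t) = bind_pmf (pmf_of_set {1..k}) (\<lambda>m. g (?t m))"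
    unfolding step_law_def g_def upd comp_apply ..
  then have "step_law k v (x \<circ> ?t) = bind_pmf (map_pmf ?t (pmf_of_set {1..k})) g"
    by (simp add: bind_map_pmf)
  ultimately show ?thesis
    unfolding step_law_def g_def by (simp add: map_bind_pmf map_pmf_comp)
qed

text \<open>A finite-horizon substitute for the strong Markov property at the meeting time.\<close>

lemma map_exchange_path_pmf:
  assumes ab: "a \<in> {1..k}" "b \<in> {1..k}"
  shows "map_pmf (exchange a b N) (path_pmf k W x0 n) = path_pmf k W x0 n"
proof (induction n)
  case 0
  have "exchange a b N (stop_path 0 c) = stop_path 0 c" for c
    by (auto simp: exchange_def stop_path_def fun_eq_iff)
  then show ?case by simp
next
  case (Suc n)
  let ?ex = "exchange a b N"
  let ?step = "\<lambda>h. map_pmf (\<lambda>y. h(Suc n := y)) (next_law k W h n)"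
  have "map_pmf ?ex (?step h) = ?step (?ex h)" if h: "h \<in> set_pmf (path_pmf k W x0 n)" for h
  proof -
    \<comment> \<open>The bound \<open>Suc n\<close> makes \<open>met\<close> depend on the path up
      to time \<open>n\<close> only, so \<open>\<tau>\<close> is fixed before the next configuration
      \<open>y\<close> is drawn.\<close>
    define met where "met \<longleftrightarrow> (\<exists>i. N \<le> i \<and> i < Suc n \<and> h i a = h i b)"
    define \<tau> where "\<tau> = (if met then (\<lambda>y. y \<circ> Transposition.transpose a b) else (\<lambda>y :: nat \<Rightarrow> int. y))"
    have upd: "?ex (h(Suc n := y)) = (?ex h)(Suc n := \<tau> y)" for y
    proof
      fix i
      have "(\<exists>l. N \<le> l \<and> l < i \<and> (h(Suc n := y)) l a = (h(Suc n := y)) l b) =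
            (\<exists>l. N \<le> l \<and> l < i \<and> h l a = h l b)" if "i \<le> Suc n"
        using that by (intro ex_cong1) auto
      moreover have "h i = (\<lambda>_. 0)" if "i > Suc n"
        using path_pmf_zero_after[OF h] that by simp
      ultimately show "?ex (h(Suc n := y)) i = ((?ex h)(Suc n := \<tau> y)) i"
        by (cases i "Suc n" rule: linorder_cases)
           (auto simp: exchange_def \<tau>_def met_def comp_transpose_id)
    qed
    have "?ex h n = \<tau> (h n)"
      unfolding exchange_alt \<tau>_def met_def by auto
    moreover have "path_weight k W (?ex h) n = path_weight k W h n"
      by (simp add: weight_def path_crossings_exchange[OF ab] fun_eq_iff)
    ultimately have "next_law k W (?ex h) n = map_pmf \<tau> (next_law k W h n)"
      unfolding next_law_def \<tau>_def by (simp add: step_law_transpose[OF ab] map_pmf_ident)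
    then show ?thesis
      by (simp add: map_pmf_comp upd)
  qed
  then have "map_pmf ?ex (path_pmf k W x0 (Suc n)) = bind_pmf (path_pmf k W x0 n) (\<lambda>h. ?step (?ex h))"
    unfolding path_pmf.simps map_bind_pmf by (intro bind_pmf_cong) auto
  also have "\<dots> = bind_pmf (map_pmf ?ex (path_pmf k W x0 n)) ?step"
    by (simp add: bind_map_pmf)
  finally show ?case
    unfolding Suc.IH path_pmf.simps .
qed

lemma exchange_cong:
  assumes "\<And>i. i \<le> n \<Longrightarrow> c i = c' i"
  shows "exchange a b N c n = exchange a b N c' n"
proof -
  have "(\<exists>i. N \<le> i \<and> i < n \<and> c i a = c i b) = (\<exists>i. N \<le> i \<and> i < n \<and> c' i a = c' i b)"
    using assms by (intro ex_cong1) auto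
  then show ?thesis
    unfolding exchange_def by (simp only: assms[OF order_refl])
qed

definition meet_often :: "nat \<Rightarrow> nat \<Rightarrow> (nat \<Rightarrow> nat \<Rightarrow> int) \<Rightarrow> bool" where
  "meet_often a b c \<longleftrightarrow> (\<forall>N. \<exists>n\<ge>N. c n a = c n b)"

definition separated :: "nat \<Rightarrow> nat \<Rightarrow> (nat \<Rightarrow> nat \<Rightarrow> int) set" where
  "separated a b = {c. meet_often a b c \<and>
     recurrent_path (\<lambda>n. c n a) \<and> \<not> recurrent_path (\<lambda>n. c n b)}"

text \<open>Walkers that meet infinitely often meet after every \<open>N\<close>, so the exchange
  does take place; recurrence ignores the finitely many times before it.\<close>

lemma exchange_in_separated_iff: "exchange a b N c \<in> separated a b \<longleftrightarrow> c \<in> separated b a"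
proof (cases "meet_often a b c")
  case True
  then obtain i where i: "i \<ge> N" "c i a = c i b"
    by (auto simp: meet_often_def)
  have ex: "exchange a b N c n = c n \<circ> Transposition.transpose a b" if "n \<ge> Suc i" for n
    using that i by (auto simp: exchange_def)
  have "recurrent_path (\<lambda>n. exchange a b N c n a) = recurrent_path (\<lambda>n. c n b)"
    "recurrent_path (\<lambda>n. exchange a b N c n b) = recurrent_path (\<lambda>n. c n a)"
    by (rule recurrent_path_cong[of "Suc i"], simp add: ex)+
  then show ?thesis
    by (auto simp: separated_def meet_often_def exchange_meet eq_commute)
next
  case False
  then show ?thesis
    by (auto simp: separated_def meet_often_def exchange_meet eq_commute)
qed

text \<open>Each factor is discrete although there are uncountably many configurations;
  \<open>measurable_path_fun\<close> still makes \<open>path\<close> measurable.\<close>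

abbreviation path_space :: "(nat \<Rightarrow> nat \<Rightarrow> int) measure" where
  "path_space \<equiv> PiM UNIV (\<lambda>_. count_space UNIV)"

lemma separated_measurable: "separated a b \<in> sets path_space"
proof -
  have pos: "(\<lambda>c. c n m) \<in> measurable path_space (count_space UNIV)" for n m
    by (rule measurable_compose[OF measurable_component_singleton]) auto
  note [measurable] = pos
  have "{c \<in> space path_space. meet_often a b c \<and>
     recurrent_path (\<lambda>n. c n a) \<and> \<not> recurrent_path (\<lambda>n. c n b)} \<in> sets path_space"
    unfolding meet_often_def recurrent_path_iff frequently_sequentially by measurable
  then show ?thesis
    by (simp add: separated_def space_PiM)
qed

context edge_reinforced_walkers
begin

lemma measurable_path: "path \<in> measurable M path_space"
proof -
  have "(\<lambda>\<omega> n. path \<omega> n) \<in> measurable M path_space"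
  proof (rule measurable_PiM_single')
    fix n show "(\<lambda>\<omega>. path \<omega> n) \<in> measurable M (count_space UNIV)"
      by (rule measurable_path_fun[of n]) simp
  qed auto
  then show ?thesis by simp
qed

lemma measurable_exchange_path: "(\<lambda>\<omega>. exchange a b N (path \<omega>)) \<in> measurable M path_space"
proof -
  have "(\<lambda>\<omega> n. exchange a b N (path \<omega>) n) \<in> measurable M path_space"
  proof (rule measurable_PiM_single')
    fix n show "(\<lambda>\<omega>. exchange a b N (path \<omega>) n) \<in> measurable M (count_space UNIV)"
      by (rule measurable_path_fun[of n]) (rule exchange_cong)
  qed auto
  then show ?thesis by simp
qed

text \<open>A finite measure on the product is determined by boxes over finitely many times; there
  both laws reduce to \<open>path_pmf\<close>, which the exchange preserves.\<close>

lemma distr_exchange_path: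
  assumes ab: "a \<in> {1..k}" "b \<in> {1..k}"
  shows "distr M path_space (\<lambda>\<omega>. exchange a b N (path \<omega>)) = distr M path_space path"
proof (rule measure_eqI_PiM_infinite)
  fix A :: "nat \<Rightarrow> (nat \<Rightarrow> int) set" and J :: "nat set"
  assume J: "finite J" "J \<subseteq> UNIV"
  let ?box = "prod_emb UNIV (\<lambda>_. count_space UNIV) J (Pi\<^sub>E J A)"
  have box: "?box \<in> sets path_space"
    using J by (intro sets_PiM_I) auto
  have in_box: "c \<in> ?box \<longleftrightarrow> (\<forall>i\<in>J. c i \<in> A i)" for c
    by (simp add: prod_emb_iff Pi_iff)
  define n where "n = Max (insert 0 J)"
  have n: "i \<le> n" if "i \<in> J" for i
    using J that by (auto simp: n_def)
  \<comment> \<open>Used for the identity and for the exchange. By \<open>cong\<close>,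
    \<open>f\<close> looks only at the past, so truncating at \<open>n\<close> does not affect the
    box.\<close>
  have fin_dim: "emeasure (distr M path_space (\<lambda>\<omega>. f (path \<omega>))) ?box =
      emeasure (map_pmf f (path_pmf k W x0 n)) ?box"
    if f: "(\<lambda>\<omega>. f (path \<omega>)) \<in> measurable M path_space"
      and cong: "\<And>c c' i. (\<And>j. j \<le> i \<Longrightarrow> c j = c' j) \<Longrightarrow> f c i = f c' i"
    for f :: "(nat \<Rightarrow> nat \<Rightarrow> int) \<Rightarrow> nat \<Rightarrow> nat \<Rightarrow> int"
  proof -
    have "f (stop_path n c) i = f c i" if "i \<in> J" for c i
      by (rule cong) (use n[OF that] in \<open>auto simp: stop_path_def\<close>)
    then have "f (path \<omega>) \<in> ?box \<longleftrightarrow> stop_path n (path \<omega>) \<in> f -` ?box" for \<omega>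
      by (simp add: in_box)
    then have "(\<lambda>\<omega>. f (path \<omega>)) -` ?box \<inter> space M =
        (\<lambda>\<omega>. stop_path n (path \<omega>)) -` (f -` ?box) \<inter> space M"
      by blast
    then show ?thesis
      by (simp add: emeasure_distr[OF f box] distr_stop_path[symmetric]
          emeasure_distr[OF measurable_stop_path])
  qed
  have "emeasure (distr M path_space path) ?box = emeasure (path_pmf k W x0 n) ?box"
    using fin_dim[of "\<lambda>c. c"] measurable_path by (simp add: map_pmf_ident)
  moreover have "emeasure (distr M path_space (\<lambda>\<omega>. exchange a b N (path \<omega>))) ?box =
      emeasure (path_pmf k W x0 n) ?box"
    using fin_dim[of "exchange a b N", OF measurable_exchange_path exchange_cong]
    by (simp add: map_exchange_path_pmf[OF ab] del: emeasure_map_pmf)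
  ultimately show "emeasure (distr M path_space (\<lambda>\<omega>. exchange a b N (path \<omega>))) ?box =
      emeasure (distr M path_space path) ?box"
    by simp
next
  show "finite_measure (distr M path_space (\<lambda>\<omega>. exchange a b N (path \<omega>)))"
    by (intro finite_measure_distr measurable_exchange_path)
qed auto

text \<open>
  The events \<open>separated a b\<close> and \<open>separated b a\<close> have equal mass on every cylinder, as the walkers
  can be exchanged after the times that the cylinder depends on. Hence they have equal mass on
  every measurable set, in particular on \<open>separated a b\<close> itself, which is disjoint from
  \<open>separated b a\<close>.
\<close>

lemma AE_not_separated:
  assumes ab: "a \<in> {1..k}" "b \<in> {1..k}"
  shows "AE \<omega> in M. path \<omega> \<notin> separated a b"
proof -
  let ?\<mu> = "distr M path_space path"
  note [measurable] = separated_measurable measurable_path measurable_exchange_path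
  interpret \<mu>: prob_space ?\<mu> by (rule prob_space_distr) measurable
  have density_eq: "emeasure (density ?\<mu> (indicator E)) A = emeasure ?\<mu> (A \<inter> E)"
    if "A \<in> sets path_space" "E \<in> sets path_space" for A E
    using that by (subst emeasure_density)
      (auto simp: indicator_inter_arith[symmetric] Int_commute intro!: nn_integral_indicator
        simp del: nn_integral_indicator simp flip: nn_integral_indicator)
  have "density ?\<mu> (indicator (separated a b)) = density ?\<mu> (indicator (separated b a))"
  proof (rule measure_eqI_PiM_infinite)
    fix A :: "nat \<Rightarrow> (nat \<Rightarrow> int) set" and J :: "nat set"
    assume J: "finite J" "J \<subseteq> UNIV"
    let ?box = "prod_emb UNIV (\<lambda>_. count_space UNIV) J (Pi\<^sub>E J A)"
    have box[measurable]: "?box \<in> sets path_space"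
      using J by (intro sets_PiM_I) auto
    define N where "N = Max (insert 0 J)"
    have "i \<le> N" if "i \<in> J" for i
      using J that by (auto simp: N_def)
    then have "exchange a b N c \<in> ?box \<longleftrightarrow> c \<in> ?box" for c
      by (simp add: prod_emb_iff Pi_iff exchange_before)
    then have "(\<lambda>\<omega>. exchange a b N (path \<omega>)) -` (?box \<inter> separated a b) \<inter> space M =
        path -` (?box \<inter> separated b a) \<inter> space M"
      by (auto simp: exchange_in_separated_iff)
    then have "emeasure (distr M path_space (\<lambda>\<omega>. exchange a b N (path \<omega>))) (?box \<inter> separated a b) =
        emeasure ?\<mu> (?box \<inter> separated b a)"
      by (simp add: emeasure_distr)
    then show "emeasure (density ?\<mu> (indicator (separated a b))) ?box =
        emeasure (density ?\<mu> (indicator (separated b a))) ?box"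
      unfolding distr_exchange_path[OF ab] by (simp add: density_eq)
  next
    show "finite_measure (density ?\<mu> (indicator (separated a b)))"
      by (rule finite_measureI) (simp add: density_eq)
  qed auto
  from arg_cong[OF this, of "\<lambda>P. emeasure P (separated a b)"]
  have "emeasure ?\<mu> (separated a b) = emeasure ?\<mu> (separated a b \<inter> separated b a)"
    by (simp add: density_eq)
  also have "separated a b \<inter> separated b a = {}"
    by (auto simp: separated_def)
  finally have "separated a b \<in> null_sets ?\<mu>"
    by (intro null_setsI) auto
  then have "AE c in ?\<mu>. c \<notin> separated a b"
    by (rule AE_not_in)
  then show ?thesis
    by (rule AE_distrD[OF measurable_path])
qed

lemma AE_all_recurrent_or_all_finite_range:
  assumes "finite {j. W j 0 \<noteq> 1}"
  shows "AE \<omega> in M. (\<forall>m\<in>{1..k}. recurrent_path (\<lambda>n. path \<omega> n m)) \<or>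
    (\<forall>m\<in>{1..k}. finite_range_path (\<lambda>n. path \<omega> n m))"
proof -
  have "AE \<omega> in M. \<forall>a\<in>{1..k}. \<forall>b\<in>{1..k}. path \<omega> \<notin> separated a b"
    by (intro AE_finite_allI AE_not_separated) auto
  with AE_path_legal AE_finite_fresh[OF assms] show ?thesis
  proof eventually_elim
    case (elim \<omega>)
    interpret legal_path k "path \<omega>"
      by unfold_locales (use elim in blast)
    show ?case
    proof (rule all_recurrent_or_all_finite_range)
      fix a b
      assume ab: "a \<in> {1..k}" "b \<in> {1..k}"
        and "\<exists>\<^sub>F n in sequentially. path \<omega> n a = path \<omega> n b" "recurrent_path (\<lambda>n. path \<omega> n a)"
      moreover have "path \<omega> \<notin> separated a b"
        using elim(3) ab by blast
      ultimately show "recurrent_path (\<lambda>n. path \<omega> n b)"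
        by (simp add: separated_def meet_often_def frequently_sequentially)
    qed (use elim(2) in blast)+
  qed
qed

end

section \<open>Disjointness and measurability of the two events\<close>

lemma not_recurrent_and_finite_range:
  assumes "recurrent_path p" "finite_range_path p"
  shows False
proof -
  have "\<exists>n. p n = x" for x
    using assms(1) unfolding recurrent_path_iff by (blast dest: frequently_ex)
  then have "surj p"
    by (metis surjI)
  with assms(2) show False
    by (simp add: finite_range_path_def infinite_UNIV_int)
qed

text \<open>Quantifiers over integer bounds and times are countable, which yields measurability of
  the event.\<close>

lemma finite_range_path_iff: "finite_range_path p \<longleftrightarrow> (\<exists>b. \<forall>n. p n \<in> {-b..b})"
proof
  assume "finite_range_path p"
  then have "finite (abs ` range p)"
    by (simp add: finite_range_path_def)
  then have "\<bar>p n\<bar> \<le> Max (abs ` range p)" for n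
    by (rule Max_ge) simp
  then show "\<exists>b. \<forall>n. p n \<in> {-b..b}"
    by (meson abs_le_D1 abs_le_D2 atLeastAtMost_iff minus_le_iff)
next
  assume "\<exists>b. \<forall>n. p n \<in> {-b..b}"
  then obtain b where "range p \<subseteq> {-b..b}" by blast
  then show "finite_range_path p"
    unfolding finite_range_path_def by (rule finite_subset) simp
qed

theorem theorem5p17:
  fixes M :: "'a measure" and k :: nat and W :: "int \<Rightarrow> nat \<Rightarrow> real"
    and x0 :: "nat \<Rightarrow> int" and X :: "nat \<Rightarrow> nat \<Rightarrow> 'a \<Rightarrow> int"
  assumes "edge_reinforced_walkers M k W x0 X"
    and "finite {j. W j 0 \<noteq> 1}"
  shows "\<P>(\<omega> in M. \<forall>m\<in>{1..k}. recurrent_path (\<lambda>n. X m n \<omega>)) +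
         \<P>(\<omega> in M. \<forall>m\<in>{1..k}. finite_range_path (\<lambda>n. X m n \<omega>)) = 1"
proof -
  interpret edge_reinforced_walkers M k W x0 X by (rule assms(1))
  let ?R = "{\<omega> \<in> space M. \<forall>m\<in>{1..k}. recurrent_path (\<lambda>n. X m n \<omega>)}"
  let ?F = "{\<omega> \<in> space M. \<forall>m\<in>{1..k}. finite_range_path (\<lambda>n. X m n \<omega>)}"
  have R: "?R \<in> events"
  proof (intro sets.sets_Collect_finite_All)
    fix m assume "m \<in> {1..k}"
    note [measurable] = walker_measurable[OF this]
    show "{\<omega> \<in> space M. recurrent_path (\<lambda>n. X m n \<omega>)} \<in> events"
      unfolding recurrent_path_iff frequently_sequentially by measurable
  qed simp
  have F: "?F \<in> events"
  proof (intro sets.sets_Collect_finite_All)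
    fix m assume m: "m \<in> {1..k}"
    have [measurable]: "(\<lambda>\<omega>. X m n \<omega>) \<in> borel_measurable M" for n
      by (rule measurable_compose[OF walker_measurable[OF m]]) simp
    show "{\<omega> \<in> space M. finite_range_path (\<lambda>n. X m n \<omega>)} \<in> events"
      unfolding finite_range_path_iff by measurable
  qed simp
  \<comment> \<open>\<open>k \<ge> 1\<close> provides a walker that would have to satisfy both;
    without walkers both events would be the whole space.\<close>
  have "?R \<inter> ?F = {}"
    using not_recurrent_and_finite_range at_least_one_walker by fastforce
  then have "prob ?R + prob ?F = prob (?R \<union> ?F)"
    using R F by (simp add: finite_measure_Union)
  also have "\<dots> = 1"
  proof (subst prob_eq_1)
    have "AE \<omega> in M. (\<forall>m\<in>{1..k}. recurrent_path (\<lambda>n. X m n \<omega>)) \<or>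
        (\<forall>m\<in>{1..k}. finite_range_path (\<lambda>n. X m n \<omega>))"
      using AE_all_recurrent_or_all_finite_range[OF assms(2)]
      by (rule eventually_mono) (simp add: path_def)
    with AE_space show "AE \<omega> in M. \<omega> \<in> ?R \<union> ?F"
      by eventually_elim auto
  qed (use R F in auto)
  finally show ?thesis .
qed

end
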